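(* The \textsc{Dual Weighted Coloring} problem admits a kernel with at most $(2^{k-1}+1)\cdot(k-1)$ vertices; that is, there is a polynomial-time algorithm that, given an instance $(G,w,k)$, outputs an equivalent instance $(G',w',k')$ of \textsc{Dual Weighted Coloring} with $|V(G')|\le (2^{k-1}+1)(k-1)$ and $k'\le k$.
   Context: All graphs are finite, simple and undirected. A proper coloring of a graph $G$ is a partition of $V(G)$ into stable sets $S_1,\ldots,S_r$, called colors. Given $w: V(G)\to \mathbb{Z}_{>0}$, the weight of a color $S_i$ is $\max_{v\in S_i} w(v)$ and the weight of a coloring is the sum of the weights of its colors. $\sigma(G,w)$ is the minimum weight of a proper coloring of $G$. \textsc{Dual Weighted Coloring}: given $(G,w)$ with positive integer weights and a positive integer $k$ (the parameter), decide whether $\sigma(G,w)\le \sum_{v\in V(G)} w(v)-k$. A kernel is a polynomial-time algorithm mapping an instance $(x,k)$ to an equivalent instance $(x',k')$ of the same problem whose size and parameter are bounded by a function of $k$.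
   Formalization: For k = 1 the output parameter k' may be 0: the bound forces the empty graph, a no-instance for every positive k', while e.g. two nonadjacent vertices with k = 1 form a yes-instance; for k ≥ 2, k' is positive as stated. *)

theory Defs
  imports
    "Graph_Theory.Pair_Digraph"
    "HOL-Library.Disjoint_Sets"
    "HOL-Library.Log_Nat"
    "HOL-Computational_Algebra.Polynomial"
begin

section \<open>Weighted colorings\<close>

text \<open>
  A finite simple undirected graph is a finite, loop-free, symmetric set of pairs:
  \<^locale>\<open>pair_graph\<close>.
\<close>

definition stable_set :: "'a pair_pre_digraph \<Rightarrow> 'a set \<Rightarrow> bool" where
  "stable_set G S \<longleftrightarrow> S \<subseteq> pverts G \<and> (\<forall>u\<in>S. \<forall>v\<in>S. (u, v) \<notin> parcs G)"

definition proper_coloring :: "'a pair_pre_digraph \<Rightarrow> 'a set set \<Rightarrow> bool" where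
  "proper_coloring G P \<longleftrightarrow> partition_on (pverts G) P \<and> (\<forall>S\<in>P. stable_set G S)"

definition color_weight :: "('a \<Rightarrow> nat) \<Rightarrow> 'a set \<Rightarrow> nat" where
  "color_weight w S = Max (w ` S)"

definition coloring_weight :: "('a \<Rightarrow> nat) \<Rightarrow> 'a set set \<Rightarrow> nat" where
  "coloring_weight w P = (\<Sum>S\<in>P. color_weight w S)"

definition sigma :: "'a pair_pre_digraph \<Rightarrow> ('a \<Rightarrow> nat) \<Rightarrow> nat" where
  "sigma G w = Min (coloring_weight w ` {P. proper_coloring G P})"

text \<open>
  The parameter may be 0 here, which gives a trivial yes-instance. A kernel needs it for \<open>k = 1\<close>:
  the vertex bound is then 0, and the empty graph is a no-instance for every positive parameter.
\<close>

definition dual_weighted_coloring :: "'a pair_pre_digraph \<Rightarrow> ('a \<Rightarrow> nat) \<Rightarrow> nat \<Rightarrow> bool" where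
  "dual_weighted_coloring G w k \<longleftrightarrow>
     int (sigma G w) \<le> (\<Sum>v\<in>pverts G. int (w v)) - int k"

definition weighted_graph :: "'a pair_pre_digraph \<Rightarrow> ('a \<Rightarrow> nat) \<Rightarrow> bool" where
  "weighted_graph G w \<longleftrightarrow> pair_graph G \<and> (\<forall>v\<in>pverts G. 0 < w v)"


section \<open>Random access machines with logarithmic cost\<close>

text \<open>
  Structured programs for a random access machine. The memory consists of banks of words
  (natural numbers); bank names occur only as constants in programs, addresses within a bank are
  computed. Every access and every operation is charged the bit lengths of the words and addresses
  involved (for a product, the product of the bit lengths of the factors), so that polynomial cost
  coincides with polynomial time on Turing machines.
\<close>

type_synonym memory = "nat \<Rightarrow> nat \<Rightarrow> nat"

datatype aexp =
    Const nat
  | Load nat aexp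
  | Add aexp aexp
  | Monus aexp aexp
  | Mult aexp aexp

datatype bexp =
    Less aexp aexp
  | Neg bexp
  | Conj bexp bexp

datatype com =
    Skip
  | Store nat aexp aexp
  | Seq com com
  | Cond bexp com com
  | While bexp com

definition word_size :: "nat \<Rightarrow> nat" where
  "word_size n = floorlog 2 n + 1"

definition words_size :: "nat list \<Rightarrow> nat" where
  "words_size xs = (\<Sum>x\<leftarrow>xs. word_size x)"

fun aval :: "aexp \<Rightarrow> memory \<Rightarrow> nat" where
  "aval (Const n) m = n"
| "aval (Load b a) m = m b (aval a m)"
| "aval (Add a1 a2) m = aval a1 m + aval a2 m"
| "aval (Monus a1 a2) m = aval a1 m - aval a2 m"
| "aval (Mult a1 a2) m = aval a1 m * aval a2 m"

fun acost :: "aexp \<Rightarrow> memory \<Rightarrow> nat" where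
  "acost (Const n) m = word_size n"
| "acost (Load b a) m = acost a m + word_size (aval a m) + word_size (m b (aval a m))"
| "acost (Add a1 a2) m = acost a1 m + acost a2 m + word_size (aval a1 m) + word_size (aval a2 m)"
| "acost (Monus a1 a2) m = acost a1 m + acost a2 m + word_size (aval a1 m) + word_size (aval a2 m)"
| "acost (Mult a1 a2) m = acost a1 m + acost a2 m + word_size (aval a1 m) * word_size (aval a2 m)"

fun bval :: "bexp \<Rightarrow> memory \<Rightarrow> bool" where
  "bval (Less a1 a2) m \<longleftrightarrow> aval a1 m < aval a2 m"
| "bval (Neg b) m \<longleftrightarrow> \<not> bval b m"
| "bval (Conj b1 b2) m \<longleftrightarrow> bval b1 m \<and> bval b2 m"

fun bcost :: "bexp \<Rightarrow> memory \<Rightarrow> nat" where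
  "bcost (Less a1 a2) m = acost a1 m + acost a2 m + word_size (aval a1 m) + word_size (aval a2 m)"
| "bcost (Neg b) m = bcost b m + 1"
| "bcost (Conj b1 b2) m = bcost b1 m + bcost b2 m + 1"

text \<open>\<open>exec c m t m'\<close>: started in memory \<open>m\<close>, program \<open>c\<close> halts in memory \<open>m'\<close> at cost \<open>t\<close>.\<close>

inductive exec :: "com \<Rightarrow> memory \<Rightarrow> nat \<Rightarrow> memory \<Rightarrow> bool" where
  Skip: "exec Skip m 1 m"
| Store: "exec (Store b a1 a2) m
    (acost a1 m + acost a2 m + word_size (aval a1 m) + word_size (aval a2 m))
    (m(b := (m b)(aval a1 m := aval a2 m)))"
| Seq: "exec c1 m t1 m' \<Longrightarrow> exec c2 m' t2 m'' \<Longrightarrow> exec (Seq c1 c2) m (t1 + t2) m''"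
| CondTrue: "bval b m \<Longrightarrow> exec c1 m t m' \<Longrightarrow> exec (Cond b c1 c2) m (bcost b m + t) m'"
| CondFalse: "\<not> bval b m \<Longrightarrow> exec c2 m t m' \<Longrightarrow> exec (Cond b c1 c2) m (bcost b m + t) m'"
| WhileFalse: "\<not> bval b m \<Longrightarrow> exec (While b c) m (bcost b m) m"
| WhileTrue: "bval b m \<Longrightarrow> exec c m t1 m' \<Longrightarrow> exec (While b c) m' t2 m'' \<Longrightarrow>
    exec (While b c) m (bcost b m + t1 + t2) m''"

text \<open>
  The input is placed in bank 0 and the output is read from bank 1, in both cases preceded by its
  length in cell 0; all other cells are initially 0.
\<close>

definition input_memory :: "nat list \<Rightarrow> memory" where
  "input_memory xs = (\<lambda>b i. if b = 0 \<and> i \<le> length xs then (length xs # xs) ! i else 0)"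

definition output_words :: "memory \<Rightarrow> nat list" where
  "output_words m = map (\<lambda>i. m 1 (Suc i)) [0..<m 1 0]"

text \<open>
  The size of the output is added to the cost: otherwise a program could announce an exponentially
  long output, consisting of cells never written, by a single store to the length cell.
\<close>

definition computes :: "com \<Rightarrow> nat list \<Rightarrow> nat list \<Rightarrow> nat \<Rightarrow> bool" where
  "computes c xs ys t \<longleftrightarrow>
     (\<exists>t' m. exec c (input_memory xs) t' m \<and> output_words m = ys \<and> t = t' + words_size ys)"


section \<open>Encoding of instances\<close>

text \<open>
  Instances handled by programs have the vertices \<open>0, \<dots>, n - 1\<close>. They are written as the number of
  vertices, the parameter, the weights and the adjacency matrix, row by row. As the size of a word
  is its bit length, weights and parameter count as binary numbers.
\<close>

definition standard_vertices :: "nat pair_pre_digraph \<Rightarrow> bool" where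
  "standard_vertices G \<longleftrightarrow> pverts G = {..<card (pverts G)}"

definition encode :: "nat pair_pre_digraph \<Rightarrow> (nat \<Rightarrow> nat) \<Rightarrow> nat \<Rightarrow> nat list" where
  "encode G w k = (let n = card (pverts G) in
     [n, k] @ map w [0..<n] @
     concat (map (\<lambda>u. map (\<lambda>v. if (u, v) \<in> parcs G then 1 else 0) [0..<n]) [0..<n]))"

end

theory Submission
  imports Defs
begin

text \<open>
  Let \<open>H\<close> be the complement of \<open>G\<close>. The saving of a color is the sum of all its weights but the
  largest, and the question is whether the savings add up to \<open>k\<close>. In a class of vertices with the
  same neighbourhood \<open>T\<close> in \<open>H\<close>, every member sharing its color with another vertex uses up a vertex
  of \<open>T\<close>; by exchange it suffices to keep the \<open>|T|\<close> heaviest members of each class. Weights may be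
  truncated at \<open>k\<close>.

  If \<open>H\<close> has a matching of size \<open>k\<close>, the answer is yes. Otherwise let \<open>M\<close> be a maximum matching, with
  \<open>m < k\<close> edges. By maximality the unmatched vertices are independent in \<open>H\<close>, and apart from at most
  one unmatched vertex for each of \<open>t\<close> exceptional edges, their neighbourhoods in \<open>H\<close> are subsets of a
  set of at most \<open>m - t\<close> endpoints. So at most \<open>2m + t + (2^(m-t) - 1)(m - t) \<le> (2^m + 1)m\<close> vertices are
  kept. Hence no matching has to be computed: if more than \<open>(2^(k-1) + 1)(k - 1)\<close> vertices are kept,
  the answer is yes.
\<close>

section \<open>Savings of colorings\<close>

definition edge_free :: "('a \<times> 'a) set \<Rightarrow> 'a set \<Rightarrow> bool" where
  "edge_free E S \<longleftrightarrow> (\<forall>u\<in>S. \<forall>v\<in>S. (u, v) \<notin> E)"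

text \<open>The inequality is written with a sum because subtraction of naturals truncates. The
  vertex set is separate from the edge relation, so that deleting vertices changes only
  \<open>A\<close>.\<close>

definition saves :: "('a \<times> 'a) set \<Rightarrow> ('a \<Rightarrow> nat) \<Rightarrow> 'a set \<Rightarrow> nat \<Rightarrow> bool" where
  "saves E w A k \<longleftrightarrow>
     (\<exists>P. partition_on A P \<and> (\<forall>S\<in>P. edge_free E S) \<and> coloring_weight w P + k \<le> sum w A)"

text \<open>The neighbourhood of \<open>v\<close> in the complement of the graph induced on
  \<open>A\<close>.\<close>

definition non_neighbours :: "('a \<times> 'a) set \<Rightarrow> 'a set \<Rightarrow> 'a \<Rightarrow> 'a set" where
  "non_neighbours E A v = {u \<in> A. u \<noteq> v \<and> (v, u) \<notin> E}"

text \<open>The minimum in \<open>sigma\<close> ranges over a finite set, and a nonempty one because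
  singletons form a proper coloring; so it is below a bound exactly when some coloring is.\<close>

lemma dual_weighted_coloring_iff_saves:
  assumes "weighted_graph G w"
  shows "dual_weighted_coloring G w k \<longleftrightarrow> saves (parcs G) w (pverts G) k"
proof -
  interpret pair_graph G using assms by (simp add: weighted_graph_def)
  let ?C = "{P. proper_coloring G P}"
  have eq: "?C = {P. partition_on (pverts G) P \<and> (\<forall>S\<in>P. edge_free (parcs G) S)}"
    by (auto simp: proper_coloring_def stable_set_def edge_free_def dest: partition_onD1)
  have fin: "finite ?C"
    by (rule finite_subset[OF _ finitely_many_partition_on[OF pair_finite_verts]])
      (auto simp: proper_coloring_def)
  have "(\<lambda>x. {x}) ` pverts G \<in> ?C"
    unfolding eq using pair_no_loops partition_on_singletons by (fastforce simp: edge_free_def)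
  then have ne: "?C \<noteq> {}" by blast
  have "dual_weighted_coloring G w k \<longleftrightarrow> sigma G w \<le> sum w (pverts G) - k \<and> k \<le> sum w (pverts G)"
    unfolding dual_weighted_coloring_def of_nat_sum[symmetric] by linarith
  also have "\<dots> \<longleftrightarrow> (\<exists>P\<in>?C. coloring_weight w P + k \<le> sum w (pverts G))"
    using fin ne by (auto simp: sigma_def Min_le_iff)
  finally show ?thesis by (auto simp: saves_def eq)
qed

lemma sum_partition_on:
  assumes "finite A" "partition_on A P"
  shows "sum w A = (\<Sum>S\<in>P. sum w S)"
proof -
  have "\<forall>S\<in>P. finite S" "\<forall>S\<in>P. \<forall>T\<in>P. S \<noteq> T \<longrightarrow> S \<inter> T = {}"
    using assms partition_onD1[OF assms(2)] partition_onD2[OF assms(2)]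
    by (auto intro: finite_subset simp: disjoint_def)
  then have "sum w (\<Union>P) = (\<Sum>S\<in>P. sum w S)"
    by (subst sum.Union_disjoint) auto
  then show ?thesis using partition_onD1[OF assms(2)] by simp
qed

lemma partition_on_memD:
  assumes "finite A" "partition_on A P" "S \<in> P"
  shows "finite S" "S \<noteq> {}" "S \<subseteq> A"
  using assms partition_onD1[OF assms(2)] partition_onD3[OF assms(2)] by (auto intro: finite_subset)

lemma partition_on_unique:
  assumes "partition_on A P" "S \<in> P" "T \<in> P" "x \<in> S" "x \<in> T"
  shows "S = T"
  using partition_onD2[OF assms(1)] assms(2-) by (auto simp: disjoint_def)

lemma partition_on_remove:
  assumes "partition_on A P" "S \<in> P"
  shows "partition_on (A - S) (P - {S})"
proof -
  have "disjnt S (\<Union>(P - {S}))"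
    using partition_onD2[OF assms(1)] assms(2) by (auto simp: disjoint_def disjnt_def)
  moreover have "insert S (P - {S}) = P" using assms(2) by blast
  ultimately show ?thesis using partition_on_insert[of S "P - {S}" A] assms(1) by simp
qed

section \<open>Deletion of light twins\<close>

text \<open>If every vertex of \<open>insert r D\<close> shared its color, choosing a companion for
  each would map \<open>card D + 1\<close> vertices injectively into the common non-neighbourhood,
  which has at most \<open>card D\<close> elements. So one of them, \<open>d\<close>, is a color by
  itself. Putting \<open>d\<close> in the place of \<open>r\<close> removes \<open>r\<close> without
  losing any saving.\<close>

lemma saves_imp_saves_delete:
  assumes fin: "finite A" and sym: "sym E" and irr: "irrefl E" and r: "r \<in> A"
    and D: "D \<subseteq> A - {r}"
    and twin: "\<And>d. d \<in> D \<Longrightarrow> non_neighbours E A d = non_neighbours E A r"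
    and heavy: "\<And>d. d \<in> D \<Longrightarrow> w r \<le> w d"
    and card: "card (non_neighbours E A r) \<le> card D"
    and saves: "saves E w A k"
  shows "saves E w (A - {r}) k"
proof -
  let ?T = "non_neighbours E A r"
  from saves obtain P where P: "partition_on A P" and st: "\<forall>S\<in>P. edge_free E S"
    and wt: "coloring_weight w P + k \<le> sum w A" by (auto simp: saves_def)
  have finP: "finite P" using finite_elements[OF fin P] .
  have twin': "non_neighbours E A x = ?T" if "x \<in> insert r D" for x using that twin by auto
  have "\<exists>d\<in>insert r D. {d} \<in> P"
  proof (rule ccontr)
    assume neg: "\<not> ?thesis"
    have "\<exists>S\<in>P. \<exists>t. x \<in> S \<and> t \<in> S \<and> t \<noteq> x" if x: "x \<in> insert r D" for x
    proof -
      have "x \<in> A" using x r D by auto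
      then obtain S where S: "S \<in> P" "x \<in> S" using partition_onD1[OF P] by auto
      moreover have "S \<noteq> {x}" using S neg x by auto
      ultimately show ?thesis by blast
    qed
    then obtain C f where C: "\<And>x. x \<in> insert r D \<Longrightarrow> C x \<in> P \<and> x \<in> C x \<and> f x \<in> C x \<and> f x \<noteq> x"
      by metis
    \<comment> \<open>A vertex \<open>y\<close> that is a non-neighbour of its twin \<open>x\<close>
      would be a non-neighbour of itself. Hence twins are adjacent and have different
      colors.\<close>
    have clash: "C x \<noteq> C y" if xy: "x \<in> insert r D" "y \<in> insert r D" "x \<noteq> y" for x y
    proof
      assume "C x = C y"
      then have "(x, y) \<notin> E" "y \<in> A"
        using C[OF xy(1)] C[OF xy(2)] st partition_onD1[OF P] by (auto simp: edge_free_def)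
      then have "y \<in> non_neighbours E A x" using xy(3) by (auto simp: non_neighbours_def)
      then have "y \<in> non_neighbours E A y" using twin'[OF xy(1)] twin'[OF xy(2)] by simp
      then show False by (simp add: non_neighbours_def)
    qed
    have "inj_on f (insert r D)"
    proof (rule inj_onI, rule ccontr)
      fix x y assume xy: "x \<in> insert r D" "y \<in> insert r D" "f x = f y" "x \<noteq> y"
      have "C x = C y"
        using partition_on_unique[OF P, of "C x" "C y" "f x"] C[OF xy(1)] C[OF xy(2)] xy(3) by auto
      then show False using clash xy by blast
    qed
    moreover have "f ` insert r D \<subseteq> ?T"
    proof (rule image_subsetI)
      fix x assume x: "x \<in> insert r D"
      have "f x \<in> non_neighbours E A x"
        using C[OF x] st partition_onD1[OF P] by (auto simp: non_neighbours_def edge_free_def)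
      then show "f x \<in> ?T" using twin'[OF x] by simp
    qed
    moreover have "finite ?T" using fin by (simp add: non_neighbours_def)
    ultimately have "card (insert r D) \<le> card ?T" by (metis card_image card_mono)
    moreover have "finite D" "r \<notin> D" using fin D by (auto intro: finite_subset)
    ultimately show False using card by simp
  qed
  then obtain d where d: "d \<in> insert r D" "{d} \<in> P" by blast
  have sumA: "sum w A = sum w (A - {r}) + w r" using fin r by (simp add: sum.remove)
  show ?thesis
  proof (cases "d = r")
    case True
    have "coloring_weight w P = w r + coloring_weight w (P - {{r}})"
      unfolding coloring_weight_def using finP d True by (simp add: sum.remove color_weight_def)
    then show ?thesis unfolding saves_def
      using partition_on_remove[OF P d(2)] st wt sumA True by (intro exI[of _ "P - {{r}}"]) auto
  next
    case False
    then have dD: "d \<in> D" using d by auto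
    obtain S where S: "S \<in> P" "r \<in> S" using partition_onD1[OF P] r by auto
    have dS: "d \<notin> S" using partition_on_unique[OF P d(2) S(1)] S(2) False by auto
    have SA: "S \<subseteq> A" "finite S" using partition_on_memD[OF fin P S(1)] by auto
    define P0 where "P0 = P - {{d}} - {S}"
    \<comment> \<open>\<open>d\<close> takes the place of \<open>r\<close> in the color
      \<open>S\<close>, and the color \<open>{d}\<close> disappears.\<close>
    let ?S = "insert d (S - {r})"
    have P0: "partition_on (A - {d} - S) P0" unfolding P0_def
      using partition_on_remove[OF partition_on_remove[OF P d(2)], of S] S dS by auto
    have U0: "\<Union>P0 = A - {d} - S" using partition_onD1[OF P0] by simp
    have "disjnt ?S (\<Union>P0)" unfolding U0 by (auto simp: disjnt_def)
    moreover have "A - {r} - ?S = A - {d} - S" using S by auto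
    ultimately have part: "partition_on (A - {r}) (insert ?S P0)"
      using partition_on_insert[of ?S P0 "A - {r}"] P0 SA D dD by auto
    have "(d, s) \<notin> E \<and> (s, d) \<notin> E" if "s \<in> S - {r}" for s
    proof -
      have "s \<in> ?T" using that st S SA by (auto simp: non_neighbours_def edge_free_def)
      then have "(d, s) \<notin> E" using twin[OF dD] by (auto simp: non_neighbours_def)
      then show ?thesis using sym by (auto dest: symD)
    qed
    then have "edge_free E ?S" using st S irr by (auto simp: edge_free_def irrefl_def)
    then have st': "\<forall>S\<in>insert ?S P0. edge_free E S" using st by (auto simp: P0_def)
    have notin: "?S \<notin> P0" using U0 by auto
    have "coloring_weight w P = color_weight w {d} + color_weight w S + coloring_weight w P0"
      unfolding coloring_weight_def P0_def using finP d S dS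
      by (subst sum.remove[of _ "{d}"], simp, simp, subst sum.remove[of _ S]) auto
    then have cP: "coloring_weight w P = w d + Max (w ` S) + coloring_weight w P0"
      by (simp add: color_weight_def)
    have cP': "coloring_weight w (insert ?S P0) = Max (w ` ?S) + coloring_weight w P0"
      unfolding coloring_weight_def using finP notin by (simp add: P0_def color_weight_def)
    have "Max (w ` ?S) \<le> max (w d) (Max (w ` S))"
      using SA by (subst Max_le_iff) (auto intro!: Max_ge simp: le_max_iff_disj)
    moreover have "w r \<le> Max (w ` S)" using S SA by simp
    moreover have "w r \<le> w d" using heavy dD .
    \<comment> \<open>Of the two terms on the right, the larger bounds the maximum on the left and
      each is at least \<open>w r\<close>.\<close>
    ultimately have "Max (w ` ?S) + w r \<le> w d + Max (w ` S)" by linarith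
    then have "coloring_weight w (insert ?S P0) + k \<le> sum w (A - {r})"
      using cP cP' wt sumA by linarith
    then show ?thesis unfolding saves_def using part st' by blast
  qed
qed

text \<open>With \<open>r\<close> as an additional color, both the weight of the coloring and the
  total weight grow by \<open>w r\<close>.\<close>

lemma saves_delete_imp_saves:
  assumes "finite A" "irrefl E" "r \<in> A" "saves E w (A - {r}) k"
  shows "saves E w A k"
proof -
  from assms(4) obtain P where P: "partition_on (A - {r}) P" and st: "\<forall>S\<in>P. edge_free E S"
    and wt: "coloring_weight w P + k \<le> sum w (A - {r})" by (auto simp: saves_def)
  have finP: "finite P" using finite_elements[OF _ P] assms(1) by auto
  have U: "\<Union>P = A - {r}" using partition_onD1[OF P] by simp
  have "partition_on A (insert {r} P)"
    using partition_on_insert[of "{r}" P A] P U assms(3) by (auto simp: disjnt_def)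
  moreover have "\<forall>S\<in>insert {r} P. edge_free E S" using st assms(2) by (auto simp: edge_free_def irrefl_def)
  moreover have "{r} \<notin> P" using U by auto
  then have "coloring_weight w (insert {r} P) + k \<le> sum w A"
    using wt finP assms(1,3) by (simp add: coloring_weight_def color_weight_def sum.remove[of A r])
  ultimately show ?thesis unfolding saves_def by blast
qed

text \<open>Deleting the vertices of \<open>D\<close> in the order of increasing keys, all heavier twins of a vertex are
  still present at the time of its deletion.\<close>

lemma saves_delete_light_twins:
  fixes key :: "'a \<Rightarrow> nat"
  assumes fin: "finite A" and sym: "sym E" and irr: "irrefl E"
    and key: "\<And>u v. u \<in> A \<Longrightarrow> v \<in> A \<Longrightarrow> key v < key u \<Longrightarrow> w v \<le> w u"
    and D: "D \<subseteq> A"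
    and light: "\<And>v. v \<in> D \<Longrightarrow> card (non_neighbours E A v) \<le>
      card {u \<in> A. non_neighbours E A u = non_neighbours E A v \<and> key v < key u}"
  shows "saves E w (A - D) k \<longleftrightarrow> saves E w A k"
proof -
  have "finite D" using fin D by (rule rev_finite_subset)
  then show ?thesis using D light
  proof (induction D rule: finite_ranking_induct[where f = key])
    case empty
    then show ?case by simp
  next
    case (insert r D)
    show ?case
    \<comment> \<open>The induction rule allows \<open>r\<close> to be in \<open>D\<close> already,
      in which case nothing changes.\<close>
    proof (cases "r \<in> D")
      case True
      then show ?thesis using insert by (simp add: insert_absorb)
    next
      case False
      define B where "B = A - D"
      define H where "H = {u \<in> A. non_neighbours E A u = non_neighbours E A r \<and> key r < key u}"
      have IH: "saves E w B k \<longleftrightarrow> saves E w A k" unfolding B_def using insert by auto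
      \<comment> \<open>Deletion intersects every non-neighbourhood with \<open>B\<close>, so twins
        remain twins.\<close>
      have nn: "non_neighbours E B v = non_neighbours E A v \<inter> B" for v
        by (auto simp: B_def non_neighbours_def)
      have "H \<subseteq> B - {r}" using insert.hyps by (force simp: H_def B_def)
      moreover have "non_neighbours E B d = non_neighbours E B r" if "d \<in> H" for d
        using that by (simp add: nn H_def)
      moreover have "w r \<le> w d" if "d \<in> H" for d
        using that key insert.prems by (auto simp: H_def)
      moreover have "card (non_neighbours E B r) \<le> card (non_neighbours E A r)"
        using fin by (intro card_mono) (auto simp: B_def non_neighbours_def)
      then have "card (non_neighbours E B r) \<le> card H"
        using insert.prems(2)[of r] by (simp add: H_def)
      moreover have "finite B" "r \<in> B" using fin insert False by (auto simp: B_def)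
      ultimately have "saves E w (B - {r}) k \<longleftrightarrow> saves E w B k"
        using saves_imp_saves_delete[of B E r H w k] saves_delete_imp_saves[of B E r w k] sym irr
        by blast
      moreover have "B - {r} = A - insert r D" by (auto simp: B_def)
      ultimately show ?thesis using IH by simp
    qed
  qed
qed

section \<open>Savings of single colors and truncation of weights\<close>

definition saving :: "('a \<Rightarrow> nat) \<Rightarrow> 'a set \<Rightarrow> nat" where
  "saving w S = sum w S - Max (w ` S)"

lemma saving_eq_sum:
  assumes "finite S" "x \<in> S" "\<forall>y\<in>S. w y \<le> w x"
  shows "saving w S = sum w (S - {x})"
proof -
  have "Max (w ` S) = w x" using assms by (intro Max_eqI) auto
  then show ?thesis using assms by (simp add: saving_def sum.remove)
qed

lemma ex_heaviest:
  fixes w :: "'a \<Rightarrow> nat"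
  assumes "finite S" "S \<noteq> {}"
  shows "\<exists>x\<in>S. \<forall>y\<in>S. w y \<le> w x"
proof -
  have "Max (w ` S) \<in> w ` S" using assms by simp
  then obtain x where "x \<in> S" "w x = Max (w ` S)" by auto
  then show ?thesis using assms by (intro bexI[of _ x]) auto
qed

lemma coloring_weight_add_savings:
  assumes "finite A" "partition_on A P"
  shows "coloring_weight w P + sum (saving w) P = sum w A"
proof -
  have "Max (w ` S) + saving w S = sum w S" if "S \<in> P" for S
  proof -
    have S: "finite S" "S \<noteq> {}" using partition_on_memD[OF assms that] by auto
    obtain x where x: "x \<in> S" "\<forall>y\<in>S. w y \<le> w x"
      using ex_heaviest[OF S] by blast
    have "Max (w ` S) = w x" using x S by (intro Max_eqI) auto
    then show ?thesis using saving_eq_sum[OF S(1) x] S(1) x(1) by (simp add: sum.remove)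
  qed
  then show ?thesis
    by (simp add: sum_partition_on[OF assms] coloring_weight_def color_weight_def
      sum.distrib[symmetric])
qed

lemma saves_iff_saving:
  assumes "finite A"
  shows "saves E w A k \<longleftrightarrow>
    (\<exists>P. partition_on A P \<and> (\<forall>S\<in>P. edge_free E S) \<and> k \<le> sum (saving w) P)"
proof -
  have "coloring_weight w P + k \<le> sum w A \<longleftrightarrow> k \<le> sum (saving w) P" if "partition_on A P" for P
    using coloring_weight_add_savings[OF assms that, of w] by linarith
  then show ?thesis unfolding saves_def by blast
qed

lemma min_sum_le_sum_min:
  fixes f :: "'a \<Rightarrow> nat"
  assumes "finite A"
  shows "min k (sum f A) \<le> (\<Sum>x\<in>A. min k (f x))"
  using assms by (induction A rule: finite_induct) auto

text \<open>Truncation keeps a heaviest vertex heaviest, so both savings omit the same vertex and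
  the sums over the others can be compared; the second part is subadditivity of truncation.\<close>

lemma saving_truncate:
  assumes "finite S" "S \<noteq> {}"
  shows "saving (\<lambda>v. min k (w v)) S \<le> saving w S"
    and "min k (saving w S) \<le> saving (\<lambda>v. min k (w v)) S"
proof -
  obtain x where x: "x \<in> S" "\<forall>y\<in>S. w y \<le> w x"
      using ex_heaviest[OF assms] by blast
  have 1: "saving w S = sum w (S - {x})" using saving_eq_sum[OF assms(1) x] .
  have 2: "saving (\<lambda>v. min k (w v)) S = (\<Sum>v\<in>S - {x}. min k (w v))"
    using x by (intro saving_eq_sum[OF assms(1)]) (auto simp: min.coboundedI2)
  show "saving (\<lambda>v. min k (w v)) S \<le> saving w S" unfolding 1 2 by (rule sum_mono) simp
  show "min k (saving w S) \<le> saving (\<lambda>v. min k (w v)) S"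
    unfolding 1 2 using assms by (intro min_sum_le_sum_min) auto
qed

text \<open>A truncated saving falls short of the original one only where it is already at least
  \<open>k\<close>, so reaching a total of \<open>k\<close> is not affected.\<close>

lemma saves_truncate:
  assumes fin: "finite A"
  shows "saves E (\<lambda>v. min k (w v)) A k \<longleftrightarrow> saves E w A k"
proof -
  have "k \<le> sum (saving (\<lambda>v. min k (w v))) P \<longleftrightarrow> k \<le> sum (saving w) P" if P: "partition_on A P" for P
  proof -
    have mem: "finite S" "S \<noteq> {}" if "S \<in> P" for S using partition_on_memD[OF fin P that] by auto
    have "min k (sum (saving w) P) \<le> (\<Sum>S\<in>P. min k (saving w S))"
      by (rule min_sum_le_sum_min[OF finite_elements[OF fin P]])
    also have "\<dots> \<le> sum (saving (\<lambda>v. min k (w v))) P"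
      by (rule sum_mono) (use saving_truncate(2) mem in blast)
    finally have "min k (sum (saving w) P) \<le> sum (saving (\<lambda>v. min k (w v))) P" .
    moreover have "sum (saving (\<lambda>v. min k (w v))) P \<le> sum (saving w) P"
      by (rule sum_mono) (use saving_truncate(1) mem in blast)
    ultimately show ?thesis by linarith
  qed
  then show ?thesis unfolding saves_iff_saving[OF fin] by blast
qed

section \<open>Renaming of vertices\<close>

text \<open>Edges need only be reflected by \<open>h\<close>: then images of edge-free sets are
  edge-free, and the colors are carried over one by one. The equivalence below applies this to
  \<open>h\<close> and to its inverse.\<close>

lemma saves_relabel_imp:
  assumes fin: "finite A" and h: "bij_betw h A B"
    and E: "\<And>u v. u \<in> A \<Longrightarrow> v \<in> A \<Longrightarrow> (h u, h v) \<in> F \<Longrightarrow> (u, v) \<in> E"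
    and w: "\<And>v. v \<in> A \<Longrightarrow> w' (h v) = w v"
    and saves: "saves E w A k"
  shows "saves F w' B k"
proof -
  from saves obtain P where P: "partition_on A P" and st: "\<forall>S\<in>P. edge_free E S"
    and wt: "coloring_weight w P + k \<le> sum w A" by (auto simp: saves_def)
  have inj: "inj_on h A" and B: "B = h ` A" using h by (auto simp: bij_betw_def)
  have sub: "S \<subseteq> A" "S \<noteq> {}" if "S \<in> P" for S using partition_on_memD[OF fin P that] by auto
  have "(`) h ` P - {{}} = (`) h ` P" using sub by auto
  then have part: "partition_on B ((`) h ` P)" using partition_on_inj_image[OF P inj] B by simp
  have "edge_free F (h ` S)" if "S \<in> P" for S
    using st that sub(1)[OF that] E by (fastforce simp: edge_free_def)
  moreover have "coloring_weight w' ((`) h ` P) = coloring_weight w P"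
  proof -
    have "inj_on ((`) h) P" using inj sub(1) by (auto simp: inj_on_def dest!: inj_on_image_eq_iff[OF inj, THEN iffD1, rotated 2])
    then have "coloring_weight w' ((`) h ` P) = (\<Sum>S\<in>P. color_weight w' (h ` S))"
      unfolding coloring_weight_def by (simp add: sum.reindex)
    also have "color_weight w' (h ` S) = color_weight w S" if "S \<in> P" for S
      using w sub(1)[OF that] by (auto simp: color_weight_def image_image intro!: arg_cong[where f = Max] image_cong)
    then have "(\<Sum>S\<in>P. color_weight w' (h ` S)) = coloring_weight w P"
      unfolding coloring_weight_def by (rule sum.cong[OF refl])
    finally show ?thesis .
  qed
  moreover have "sum w' B = sum w A" unfolding B using inj w by (simp add: sum.reindex)
  ultimately show ?thesis unfolding saves_def using part wt by (intro exI[of _ "(`) h ` P"]) auto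
qed

lemma saves_relabel:
  assumes fin: "finite A" and h: "bij_betw h A B"
    and E: "\<And>u v. u \<in> A \<Longrightarrow> v \<in> A \<Longrightarrow> (h u, h v) \<in> F \<longleftrightarrow> (u, v) \<in> E"
    and w: "\<And>v. v \<in> A \<Longrightarrow> w' (h v) = w v"
  shows "saves F w' B k \<longleftrightarrow> saves E w A k"
proof
  assume "saves E w A k"
  then show "saves F w' B k" using saves_relabel_imp[OF fin h, of F E w' w k] E w by blast
next
  assume saves: "saves F w' B k"
  let ?g = "inv_into A h"
  have g: "?g v \<in> A" "h (?g v) = v" if "v \<in> B" for v
    using that h by (auto simp: bij_betw_def inv_into_into f_inv_into_f)
  have "finite B" using fin h by (simp add: bij_betw_finite)
  then show "saves E w A k"
    using saves_relabel_imp[OF _ bij_betw_inv_into[OF h], of E F w w' k] saves E w g by metis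
qed

section \<open>Matchings in the complement and the vertex bound\<close>

text \<open>A matching in the complement: for irreflexive \<open>E\<close> and a set
  \<open>e\<close> of size 2, \<open>edge_free\<close> means that its two vertices are not
  adjacent.\<close>

definition comatching :: "('a \<times> 'a) set \<Rightarrow> 'a set \<Rightarrow> 'a set set \<Rightarrow> bool" where
  "comatching E A M \<longleftrightarrow> disjoint M \<and> (\<forall>e\<in>M. e \<subseteq> A \<and> card e = 2 \<and> edge_free E e)"

text \<open>Taken as a color, each matching edge saves the lighter of its two weights, which is at
  least 1; all other vertices are colors by themselves.\<close>

lemma comatching_saves:
  assumes fin: "finite A" and irr: "irrefl E" and pos: "\<And>v. v \<in> A \<Longrightarrow> 0 < w v"
    and M: "comatching E A M"
  shows "saves E w A (card M)"
proof -
  define P where "P = M \<union> (\<lambda>v. {v}) ` (A - \<Union>M)"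
  have sub: "\<Union>M \<subseteq> A" using M by (auto simp: comatching_def)
  have P: "partition_on A P"
  proof (rule partition_onI)
    show "\<Union>P = A" using sub by (auto simp: P_def)
    show "{} \<notin> P" using M by (auto simp: P_def comatching_def)
    show "disjnt p q" if "p \<in> P" "q \<in> P" "p \<noteq> q" for p q
      using that M by (auto simp: P_def comatching_def disjoint_def disjnt_def)
  qed
  have ef: "\<forall>S\<in>P. edge_free E S"
    using M irr by (auto simp: P_def comatching_def edge_free_def irrefl_def)
  have finP: "finite P" using finite_elements[OF fin P] .
  have "1 \<le> saving w e" if e: "e \<in> M" for e
  proof -
    have e': "finite e" "e \<noteq> {}" "card e = 2" "e \<subseteq> A"
      using M e fin by (auto simp: comatching_def intro: finite_subset)
    obtain x where x: "x \<in> e" "\<forall>y\<in>e. w y \<le> w x"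
      using ex_heaviest[OF e'(1,2)] by blast
    have "e - {x} \<noteq> {}" using e' x by (metis card_Diff_singleton card.empty diff_add_inverse2 one_add_one zero_neq_one)
    then obtain y where y: "y \<in> e - {x}" by blast
    have "1 \<le> w y" using pos[of y] y e'(4) by auto
    also have "\<dots> \<le> sum w (e - {x})" using y e' by (intro member_le_sum) auto
    finally show ?thesis using saving_eq_sum[OF e'(1) x] by simp
  qed
  then have "card M \<le> sum (saving w) M" using sum_mono[of M "\<lambda>_. 1" "saving w"] by simp
  also have "\<dots> \<le> sum (saving w) P" using finP by (intro sum_mono2) (auto simp: P_def)
  finally show ?thesis unfolding saves_iff_saving[OF fin] using P ef by blast
qed

lemma saves_antimono: "saves E w A k \<Longrightarrow> l \<le> k \<Longrightarrow> saves E w A l"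
  unfolding saves_def by (meson add_left_mono order_trans)

text \<open>In the bound below, one application shows that vertices outside a maximum matching have
  no complement edge between them; two in a row augment along a path of length 3.\<close>

lemma comatching_extend:
  assumes sym: "sym E" and irr: "irrefl E"
    and M: "comatching E A M" and uv: "u \<in> A - \<Union>M" "v \<in> A - \<Union>M" "u \<noteq> v" "(u, v) \<notin> E"
  shows "comatching E A (insert {u, v} M)"
proof -
  have "edge_free E {u, v}" using uv sym irr by (auto simp: edge_free_def irrefl_def dest: symD)
  moreover have "card {u, v} = 2" using uv by simp
  moreover have "disjoint (insert {u, v} M)" using M uv by (auto simp: comatching_def disjoint_def)
  ultimately show ?thesis using M uv by (auto simp: comatching_def)
qed

text \<open>The non-neighbourhoods of the vertices outside a maximum matching of the complement are
  confined to one endpoint of each matching edge, except where both endpoints see the same single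
  unmatched vertex: otherwise there is an augmenting path of length 3.\<close>

lemma card_le_if_not_saves:
  assumes fin: "finite A" and sym: "sym E" and irr: "irrefl E" and pos: "\<And>v. v \<in> A \<Longrightarrow> 0 < w v"
    and no: "\<not> saves E w A k" and K: "K \<subseteq> A"
    and classes: "\<And>T. card {v \<in> K. non_neighbours E A v = T} \<le> card T"
  shows "card K \<le> (2 ^ (k - 1) + 1) * (k - 1)"
proof -
  have finM: "finite M" if "comatching E A M" for M
    by (rule finite_subset[of _ "Pow A"]) (use that fin in \<open>auto simp: comatching_def\<close>)
  have "finite {M. comatching E A M}"
    by (rule finite_subset[of _ "Pow (Pow A)"]) (use fin in \<open>auto simp: comatching_def\<close>)
  moreover have "comatching E A {}" by (simp add: comatching_def)
  \<comment> \<open>With \<open>card\<close> as the weight, a heaviest matching is one of maximum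
    size.\<close>
  ultimately have "\<exists>M\<in>{M. comatching E A M}. \<forall>N\<in>{M. comatching E A M}. card N \<le> card M"
    by (intro ex_heaviest) auto
  then obtain M where M: "comatching E A M"
    and max: "\<And>N. comatching E A N \<Longrightarrow> card N \<le> card M" by blast
  have mk: "card M < k"
  proof (rule ccontr)
    assume "\<not> card M < k"
    moreover have "saves E w A (card M)" by (rule comatching_saves[OF fin irr _ M]) (rule pos)
    ultimately show False using saves_antimono[of E w A "card M" k] no by simp
  qed
  have edge: "e \<subseteq> A" "card e = 2" "edge_free E e" if "e \<in> M" for e
    using M that by (auto simp: comatching_def)
  define R where "R = A - \<Union>M"
  have indep: "(u, v) \<in> E" if "u \<in> R" "v \<in> R" "u \<noteq> v" for u v
  proof (rule ccontr)
    assume "(u, v) \<notin> E"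
    then have "comatching E A (insert {u, v} M)"
      using comatching_extend[OF sym irr M] that by (auto simp: R_def)
    moreover have "{u, v} \<notin> M" using that by (auto simp: R_def)
    ultimately show False using max finM[OF M] by (metis card_insert_disjoint not_less_eq_eq order_refl)
  qed
  have augment: "a = b" if e: "e \<in> M" "u \<in> e" "v \<in> e" "u \<noteq> v"
    and ab: "a \<in> R" "b \<in> R" "(u, a) \<notin> E" "(v, b) \<notin> E" for e u v a b
  proof (rule ccontr)
    assume ne: "a \<noteq> b"
    \<comment> \<open>In place of \<open>e\<close> come \<open>{u, a}\<close> and
      \<open>{v, b}\<close>, which gives a larger matching.\<close>
    let ?M = "M - {e}"
    have 1: "comatching E A ?M" using M by (auto simp: comatching_def disjoint_def)
    have "f = e" if "f \<in> M" "x \<in> f" "x \<in> e" for f x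
      using M that e(1) by (auto simp: comatching_def dest: disjointD)
    then have out: "u \<in> A - \<Union>?M" "v \<in> A - \<Union>?M" "a \<in> A - \<Union>?M" "b \<in> A - \<Union>?M"
      using e ab edge(1)[OF e(1)] unfolding R_def by blast+
    have ne': "a \<noteq> u" "b \<noteq> u" "a \<noteq> v" "b \<noteq> v" using e ab by (auto simp: R_def)
    have 2: "comatching E A (insert {u, a} ?M)"
      using comatching_extend[OF sym irr 1] out ab ne' by auto
    have 3: "comatching E A (insert {v, b} (insert {u, a} ?M))"
      using comatching_extend[OF sym irr 2] out ab ne' ne e by auto
    have "{u, a} \<notin> M" "{v, b} \<notin> M" "{v, b} \<noteq> {u, a}"
      using ab e ne' by (auto simp: R_def doubleton_eq_iff)
    then have "card (insert {v, b} (insert {u, a} ?M)) = Suc (Suc (card ?M))"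
      using finM[OF M] by simp
    also have "\<dots> = Suc (card M)" using finM[OF M] e(1) by (metis card_Suc_Diff1)
    finally show False using max[OF 3] by simp
  qed
  \<comment> \<open>\<open>B e\<close> collects the unmatched complement neighbours of the ends of
    \<open>e\<close>. The exceptional edges \<open>M2\<close> are those with such a neighbour at
    both ends.\<close>
  define B where "B e = {r \<in> R. \<exists>x\<in>e. (x, r) \<notin> E}" for e
  define M2 where "M2 = {e \<in> M. \<forall>x\<in>e. \<exists>r\<in>R. (x, r) \<notin> E}"
  have pair: "\<exists>u v. e = {u, v} \<and> u \<noteq> v" if "e \<in> M" for e
    using edge(2)[OF that] by (auto simp: card_2_iff)
  \<comment> \<open>An edge outside \<open>M2\<close> has at most one endpoint with unmatched
    complement neighbours; \<open>h\<close> picks it if it exists.\<close>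
  have "\<exists>u\<in>e. \<forall>x\<in>e. \<forall>r\<in>R. (x, r) \<notin> E \<longrightarrow> x = u" if "e \<in> M - M2" for e
    using that pair[of e] by (auto simp: M2_def)
  then obtain h where h: "\<And>e x r. e \<in> M - M2 \<Longrightarrow> x \<in> e \<Longrightarrow> r \<in> R \<Longrightarrow> (x, r) \<notin> E \<Longrightarrow> x = h e"
    by metis
  define U where "U = h ` (M - M2)"
  define R0 where "R0 = \<Union>(B ` M2)"
  have finM2: "finite M2" "M2 \<subseteq> M" using finM[OF M] by (auto simp: M2_def)
  have "card (B e) \<le> 1" if e: "e \<in> M2" for e
  proof -
    obtain u v where uv: "e = {u, v}" "u \<noteq> v" using pair e finM2 by blast
    obtain a b where ab: "a \<in> R" "b \<in> R" "(u, a) \<notin> E" "(v, b) \<notin> E"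
      using e uv by (auto simp: M2_def)
    \<comment> \<open>\<open>augment\<close> gives \<open>a = b\<close>, and \<open>r\<close> equals
      \<open>b\<close> or \<open>a\<close> according to which endpoint sees it.\<close>
    have "B e \<subseteq> {a}"
    proof
      fix r assume r: "r \<in> B e"
      then have "r \<in> R" "(u, r) \<notin> E \<or> (v, r) \<notin> E" using uv by (auto simp: B_def)
      then show "r \<in> {a}"
        using augment[of e u v r b] augment[of e u v a r] augment[of e u v a b] ab e uv finM2 by auto
    qed
    then show ?thesis using card_mono[of "{a}" "B e"] by simp
  qed
  then have "(\<Sum>e\<in>M2. card (B e)) \<le> card M2" using sum_mono[of M2 "\<lambda>e. card (B e)" "\<lambda>_. 1"] by simp
  then have cR0: "card R0 \<le> card M2"
    unfolding R0_def using card_UN_le[OF finM2(1), of B] by linarith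
  have cU: "card U \<le> card M - card M2"
    unfolding U_def using card_image_le[of "M - M2" h] finM[OF M] card_Diff_subset[OF finM2] by simp
  have finU: "finite U" using finM[OF M] by (simp add: U_def)
  have cM: "card (\<Union>M) \<le> 2 * card M"
    using card_Union_le_sum_card[of M] edge(2) by simp
  \<comment> \<open>Complement neighbours of \<open>r\<close> are matched, by \<open>indep\<close>,
    and their edges are not exceptional since \<open>r\<close> lies outside \<open>R0\<close>; so
    each is the chosen endpoint of its edge.\<close>
  have type: "non_neighbours E A r \<subseteq> U" if r: "r \<in> R - R0" for r
  proof
    fix x assume x: "x \<in> non_neighbours E A r"
    then have x': "x \<in> A" "x \<noteq> r" "(x, r) \<notin> E" using sym by (auto simp: non_neighbours_def dest: symD)
    then have "x \<notin> R" using indep[of x r] r by auto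
    then obtain e where e: "e \<in> M" "x \<in> e" using x' by (auto simp: R_def)
    moreover have "e \<notin> M2" using r e x' by (auto simp: R0_def B_def)
    ultimately have "x = h e" using h[of e x r] x' r by auto
    then show "x \<in> U" using e \<open>e \<notin> M2\<close> by (auto simp: U_def)
  qed
  let ?C = "\<lambda>T. {v \<in> K. non_neighbours E A v = T}"
  have finK: "finite K" using fin K by (rule rev_finite_subset)
  have "K \<inter> (R - R0) \<subseteq> (\<Union>T\<in>Pow U - {{}}. ?C T)"
  proof
    fix r assume r: "r \<in> K \<inter> (R - R0)"
    \<comment> \<open>A class with empty type has size at most \<open>card {} = 0\<close>, so only
      nonempty types occur.\<close>
    have "?C {} = {}" using classes[of "{}"] finK by simp
    then show "r \<in> (\<Union>T\<in>Pow U - {{}}. ?C T)" using r type[of r] by auto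
  qed
  then have "card (K \<inter> (R - R0)) \<le> card (\<Union>T\<in>Pow U - {{}}. ?C T)"
    using finK finU by (intro card_mono) auto
  also have "\<dots> \<le> (\<Sum>T\<in>Pow U - {{}}. card (?C T))" using finU by (intro card_UN_le) simp
  also have "\<dots> \<le> (\<Sum>T\<in>Pow U - {{}}. card U)"
    using classes card_mono[OF finU] by (intro sum_mono) (meson DiffD1 PowD order_trans)
  also have "\<dots> = (2 ^ card U - 1) * card U" using finU by (simp add: card_Pow)
  also have "\<dots> \<le> (2 ^ card M - 1) * (card M - card M2)"
    using cU by (intro mult_mono diff_le_mono power_increasing) auto
  finally have cC: "card (K \<inter> (R - R0)) \<le> (2 ^ card M - 1) * (card M - card M2)" .
  have le: "card M2 \<le> card M" using card_mono[OF finM[OF M] finM2(2)] .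
  \<comment> \<open>This absorbs the vertices of \<open>R0\<close>: multiplied by
    \<open>2 ^ card M - 1\<close>, the \<open>card M2\<close> missing from the second factor
    outweigh them. For an empty \<open>M\<close> both sides are 0.\<close>
  have "card M2 \<le> (2 ^ card M - 1) * card M2"
  proof (cases "card M = 0")
    case False
    then have "1 \<le> (2::nat) ^ card M - 1" using less_exp[of "card M"] by linarith
    then show ?thesis using mult_le_mono1[of 1 "2 ^ card M - 1" "card M2"] by simp
  qed (use le in simp)
  then have "(2 ^ card M - 1) * (card M - card M2) + card M2 \<le> (2 ^ card M - 1) * card M"
    using le by (metis add_mono_thms_linordered_semiring(1) add_mult_distrib2 le_add_diff_inverse2 order_refl)
  moreover have "(2 ^ card M - 1) * card M + 2 * card M = (2 ^ card M + 1) * card M"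
    by (simp add: algebra_simps diff_mult_distrib2)
  moreover have "K \<subseteq> \<Union>M \<union> R0 \<union> (K \<inter> (R - R0))" using K by (auto simp: R_def)
  then have "card K \<le> card (\<Union>M \<union> R0 \<union> (K \<inter> (R - R0)))"
  proof (rule card_mono[rotated])
    have "\<Union>M \<union> R0 \<union> (K \<inter> (R - R0)) \<subseteq> A" using edge(1) K by (auto simp: R_def R0_def B_def)
    then show "finite (\<Union>M \<union> R0 \<union> (K \<inter> (R - R0)))" using fin by (rule finite_subset)
  qed
  then have "card K \<le> card (\<Union>M) + card R0 + card (K \<inter> (R - R0))"
    by (meson add_le_mono1 card_Un_le order_trans)
  ultimately have "card K \<le> (2 ^ card M + 1) * card M" using cM cR0 cC by linarith
  also have "\<dots> \<le> (2 ^ (k - 1) + 1) * (k - 1)"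
    using mk by (intro mult_mono add_right_mono power_increasing) auto
  finally show ?thesis .
qed

section \<open>Cost of programs\<close>

text \<open>The length of a value in multiples of the word length \<open>L\<close> of the memory:
  sums and products at most add lengths, and a constant \<open>n\<close> is at most
  \<open>2 ^ n\<close>.\<close>

fun value_weight :: "aexp \<Rightarrow> nat" where
  "value_weight (Const n) = n + 1"
| "value_weight (Load b a) = 1"
| "value_weight (Add a1 a2) = value_weight a1 + value_weight a2"
| "value_weight (Monus a1 a2) = value_weight a1 + value_weight a2"
| "value_weight (Mult a1 a2) = value_weight a1 + value_weight a2"

text \<open>Mirrors \<open>acost\<close> in units of \<open>(L + 2)\<^sup>2\<close>; the square
  comes from the charge for products.\<close>

fun acost_weight :: "aexp \<Rightarrow> nat" where
  "acost_weight (Const n) = n + 1"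
| "acost_weight (Load b a) = acost_weight a + value_weight a + 1"
| "acost_weight (Add a1 a2) = acost_weight a1 + acost_weight a2 + value_weight a1 + value_weight a2"
| "acost_weight (Monus a1 a2) = acost_weight a1 + acost_weight a2 + value_weight a1 + value_weight a2"
| "acost_weight (Mult a1 a2) = acost_weight a1 + acost_weight a2 + value_weight a1 * value_weight a2"

fun bcost_weight :: "bexp \<Rightarrow> nat" where
  "bcost_weight (Less a1 a2) = acost_weight a1 + acost_weight a2 + value_weight a1 + value_weight a2"
| "bcost_weight (Neg b) = bcost_weight b + 1"
| "bcost_weight (Conj b1 b2) = bcost_weight b1 + bcost_weight b2 + 1"

text \<open>The cost of a program, in multiples of the square of the word length, as a polynomial in an
  upper bound for the number of iterations of every loop.\<close>

fun cost_poly :: "com \<Rightarrow> nat poly" where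
  "cost_poly Skip = 1"
| "cost_poly (Store b a1 a2) =
    [:acost_weight a1 + acost_weight a2 + value_weight a1 + value_weight a2:]"
| "cost_poly (Seq c1 c2) = cost_poly c1 + cost_poly c2"
| "cost_poly (Cond b c1 c2) = [:bcost_weight b:] + cost_poly c1 + cost_poly c2"
| "cost_poly (While b c) = [:1, 1:] * ([:bcost_weight b:] + cost_poly c)"

definition bounded_memory :: "nat \<Rightarrow> memory \<Rightarrow> bool" where
  "bounded_memory L m \<longleftrightarrow> (\<forall>b i. m b i \<le> 2 ^ L)"

text \<open>Since \<open>2 ^ c < 2 ^ Suc c\<close>, the bit length is at most \<open>c + 1\<close>,
  and \<open>word_size\<close> adds one.\<close>

lemma word_size_le: "x \<le> 2 ^ c \<Longrightarrow> word_size x \<le> c + 2"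
  using floorlog_leI[of x 2 "Suc c"] le_less_trans[of x "2 ^ c" "2 ^ Suc c"]
  by (simp add: word_size_def)

lemma value_weight_pos: "0 < value_weight a"
  by (induction a) auto

text \<open>Two powers that are at least 2 have a sum not exceeding their product, hence the
  positive exponents.\<close>

lemma add_le_mult_power_two:
  fixes x y :: nat
  assumes "x \<le> 2 ^ a" "y \<le> 2 ^ b" "0 < a" "0 < b"
  shows "x + y \<le> 2 ^ (a + b)"
proof -
  have "(2::nat) ^ 1 \<le> 2 ^ a" "(2::nat) ^ 1 \<le> 2 ^ b" using assms by (intro power_increasing; simp)+
  then have "(2::nat) ^ a + 2 ^ b \<le> 2 ^ a * 2 ^ b"
    by (auto dest!: le_Suc_ex)
  then show ?thesis using assms by (simp add: power_add)
qed

lemma aval_le: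
  assumes "bounded_memory L m" "0 < L"
  shows "aval a m \<le> 2 ^ (L * value_weight a)"
proof (induction a)
  case (Const n)
  have "n \<le> 2 ^ n" using less_exp[of n] by simp
  also have "\<dots> \<le> 2 ^ (L * (n + 1))"
    using assms(2) by (intro power_increasing) (cases L, auto)
  finally show ?case by simp
next
  case (Load b a)
  then show ?case using assms(1) by (simp add: bounded_memory_def)
next
  case (Add a1 a2)
  then show ?case
    using add_le_mult_power_two[OF Add] assms(2) value_weight_pos by (simp add: distrib_left)
next
  case (Monus a1 a2)
  have "aval a1 m - aval a2 m \<le> aval a1 m + aval a2 m" by simp
  then show ?case
    using add_le_mult_power_two[OF Monus] assms(2) value_weight_pos
    by (simp add: distrib_left)
next
  case (Mult a1 a2)
  then show ?case using mult_le_mono[OF Mult] by (simp add: distrib_left power_add)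
qed

lemma word_size_aval_le:
  assumes "bounded_memory L m" "0 < L"
  shows "word_size (aval a m) \<le> value_weight a * (L + 2)"
proof -
  have "word_size (aval a m) \<le> L * value_weight a + 2" using word_size_le aval_le[OF assms] by blast
  also have "\<dots> \<le> value_weight a * (L + 2)" using value_weight_pos[of a] by (simp add: algebra_simps)
  finally show ?thesis .
qed

lemma word_size_aval_le_square:
  assumes "bounded_memory L m" "0 < L"
  shows "word_size (aval a m) \<le> value_weight a * (L + 2)\<^sup>2"
proof -
  have "value_weight a * (L + 2) \<le> value_weight a * (L + 2)\<^sup>2"
    by (intro mult_le_mono2) (simp add: power2_eq_square)
  then show ?thesis using word_size_aval_le[OF assms, of a] by linarith
qed

lemma acost_le:
  assumes "bounded_memory L m" "0 < L"
  shows "acost a m \<le> acost_weight a * (L + 2)\<^sup>2"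
proof (induction a)
  case (Const n)
  show ?case using word_size_aval_le_square[OF assms, of "Const n"] by simp
next
  case (Load b a)
  show ?case
    using Load word_size_aval_le_square[OF assms, of a] word_size_aval_le_square[OF assms, of "Load b a"]
    by (simp add: distrib_right)
next
  case (Add a1 a2)
  then show ?case
    using word_size_aval_le_square[OF assms, of a1] word_size_aval_le_square[OF assms, of a2]
    by (simp add: distrib_right)
next
  case (Monus a1 a2)
  then show ?case
    using word_size_aval_le_square[OF assms, of a1] word_size_aval_le_square[OF assms, of a2]
    by (simp add: distrib_right)
next
  case (Mult a1 a2)
  have "word_size (aval a1 m) * word_size (aval a2 m) \<le>
    (value_weight a1 * (L + 2)) * (value_weight a2 * (L + 2))"
    using word_size_aval_le[OF assms] by (intro mult_le_mono)
  also have "\<dots> = value_weight a1 * value_weight a2 * (L + 2)\<^sup>2" by (simp only: power2_eq_square mult_ac)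
  finally show ?case using Mult by (simp add: distrib_right)
qed

lemma bcost_le:
  assumes "bounded_memory L m" "0 < L"
  shows "bcost b m \<le> bcost_weight b * (L + 2)\<^sup>2"
proof (induction b)
  case (Less a1 a2)
  show ?case
    using acost_le[OF assms, of a1] acost_le[OF assms, of a2]
      word_size_aval_le_square[OF assms, of a1] word_size_aval_le_square[OF assms, of a2]
    by (simp add: distrib_right)
next
  case (Neg b)
  have "1 \<le> (L + 2)\<^sup>2" by simp
  then show ?case
    unfolding bcost.simps bcost_weight.simps distrib_right mult_1_left using Neg by linarith
next
  case (Conj b1 b2)
  have "1 \<le> (L + 2)\<^sup>2" by simp
  then show ?case
    unfolding bcost.simps bcost_weight.simps distrib_right mult_1_left using Conj by linarith
qed

section \<open>Total correctness with cost bounds\<close>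

text \<open>In the style of a weakest precondition, so that sequencing is nesting. \<open>N\<close>
  bounds the iterations of loops; the word bound \<open>L\<close> is assumed before a command and
  guaranteed after it, so that costs can be bounded command by command.\<close>

definition terminates :: "nat \<Rightarrow> nat \<Rightarrow> com \<Rightarrow> (memory \<Rightarrow> bool) \<Rightarrow> memory \<Rightarrow> bool" where
  "terminates N L c Q m \<longleftrightarrow> 0 < L \<and> (bounded_memory L m \<longrightarrow>
     (\<exists>t m'. exec c m t m' \<and> bounded_memory L m' \<and> Q m' \<and> t \<le> poly (cost_poly c) N * (L + 2)\<^sup>2))"

lemma terminates_weaken:
  "terminates N L c P m \<Longrightarrow> (\<And>m. P m \<Longrightarrow> Q m) \<Longrightarrow> terminates N L c Q m"
  unfolding terminates_def by blast

lemma terminates_Store: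
  assumes "0 < L" "aval a2 m \<le> 2 ^ L" "Q (m(b := (m b)(aval a1 m := aval a2 m)))"
  shows "terminates N L (Store b a1 a2) Q m"
  unfolding terminates_def
proof (intro conjI impI)
  assume m: "bounded_memory L m"
  note m' = m assms(1)
  have "bounded_memory L (m(b := (m b)(aval a1 m := aval a2 m)))"
    using m assms(2) by (simp add: bounded_memory_def)
  moreover have "acost a1 m + acost a2 m + word_size (aval a1 m) + word_size (aval a2 m)
      \<le> poly (cost_poly (Store b a1 a2)) N * (L + 2)\<^sup>2"
    using acost_le[OF m', of a1] acost_le[OF m', of a2]
      word_size_aval_le_square[OF m', of a1] word_size_aval_le_square[OF m', of a2]
    by (simp add: distrib_right)
  ultimately show "\<exists>t m'. exec (Store b a1 a2) m t m' \<and> bounded_memory L m' \<and> Q m' \<and>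
      t \<le> poly (cost_poly (Store b a1 a2)) N * (L + 2)\<^sup>2"
    using exec.Store assms(3) by blast
qed (fact assms)

lemma terminates_Seq:
  assumes "terminates N L c1 (terminates N L c2 Q) m"
  shows "terminates N L (Seq c1 c2) Q m"
  unfolding terminates_def
proof (intro conjI impI)
  assume "bounded_memory L m"
  then obtain t1 m1 where 1: "exec c1 m t1 m1" "bounded_memory L m1"
    "t1 \<le> poly (cost_poly c1) N * (L + 2)\<^sup>2" "terminates N L c2 Q m1"
    using assms by (auto simp: terminates_def)
  then obtain t2 m2 where 2: "exec c2 m1 t2 m2" "bounded_memory L m2" "Q m2"
    "t2 \<le> poly (cost_poly c2) N * (L + 2)\<^sup>2"
    by (auto simp: terminates_def)
  have "t1 + t2 \<le> poly (cost_poly (Seq c1 c2)) N * (L + 2)\<^sup>2"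
    using 1 2 by (simp add: distrib_right)
  then show "\<exists>t m'. exec (Seq c1 c2) m t m' \<and> bounded_memory L m' \<and> Q m' \<and>
      t \<le> poly (cost_poly (Seq c1 c2)) N * (L + 2)\<^sup>2"
    using exec.Seq[OF 1(1) 2(1)] 2 by blast
qed (use assms in \<open>simp add: terminates_def\<close>)

lemma terminates_Cond:
  assumes "0 < L" "bval b m \<Longrightarrow> terminates N L c1 Q m" "\<not> bval b m \<Longrightarrow> terminates N L c2 Q m"
  shows "terminates N L (Cond b c1 c2) Q m"
  unfolding terminates_def
proof (intro conjI impI)
  assume m: "bounded_memory L m"
  define c where "c = (if bval b m then c1 else c2)"
  have "terminates N L c Q m" using assms by (simp add: c_def)
  then obtain t m' where t: "exec c m t m'" "bounded_memory L m'" "Q m'"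
    "t \<le> poly (cost_poly c) N * (L + 2)\<^sup>2"
    using m by (auto simp: terminates_def)
  have "exec (Cond b c1 c2) m (bcost b m + t) m'"
    using t(1) by (auto simp: c_def intro: exec.CondTrue exec.CondFalse split: if_splits)
  moreover have "poly (cost_poly c) N * (L + 2)\<^sup>2 \<le>
      poly (cost_poly c1) N * (L + 2)\<^sup>2 + poly (cost_poly c2) N * (L + 2)\<^sup>2"
    by (simp add: c_def)
  then have "bcost b m + t \<le> poly (cost_poly (Cond b c1 c2)) N * (L + 2)\<^sup>2"
    using t(4) bcost_le[OF m assms(1), of b] by (simp add: distrib_right)
  ultimately show "\<exists>t m'. exec (Cond b c1 c2) m t m' \<and> bounded_memory L m' \<and> Q m' \<and>
      t \<le> poly (cost_poly (Cond b c1 c2)) N * (L + 2)\<^sup>2"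
    using t by blast
qed (fact assms)

abbreviation Var :: "nat \<Rightarrow> aexp" where
  "Var b \<equiv> Load b (Const 0)"

abbreviation Assign :: "nat \<Rightarrow> aexp \<Rightarrow> com" where
  "Assign b a \<equiv> Store b (Const 0) a"

text \<open>The counter lives in cell 0 of bank \<open>b\<close>. The limit is evaluated anew before
  every round, so the rule below asks the invariant to fix its value.\<close>

definition For :: "nat \<Rightarrow> aexp \<Rightarrow> com \<Rightarrow> com" where
  "For b a c = Seq (Assign b (Const 0))
     (While (Less (Var b) a) (Seq c (Assign b (Add (Var b) (Const 1)))))"

text \<open>The invariant \<open>I j\<close> describes the memory at the start of round
  \<open>j\<close>. After the body it is required of the memory with the counter already advanced,
  which hides the increment.\<close>

lemma terminates_For:
  assumes L: "0 < L" and n: "n \<le> N" "n \<le> 2 ^ L"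
    and init: "I 0 (m(b := (m b)(0 := 0)))"
    and limit: "\<And>j m. I j m \<Longrightarrow> aval a m = n"
    and body: "\<And>j m. j < n \<Longrightarrow> I j m \<Longrightarrow> m b 0 = j \<Longrightarrow>
      terminates N L c (\<lambda>m. m b 0 = j \<and> I (Suc j) (m(b := (m b)(0 := Suc j)))) m"
    and post: "\<And>m. I n m \<Longrightarrow> Q m"
  shows "terminates N L (For b a c) Q m"
proof -
  let ?inc = "Assign b (Add (Var b) (Const 1))"
  let ?b = "Less (Var b) a"
  let ?c = "Seq c ?inc"
  let ?T = "(bcost_weight ?b + poly (cost_poly ?c) N) * (L + 2)\<^sup>2"
  have step: "terminates N L ?c (\<lambda>m. I (Suc j) m \<and> m b 0 = Suc j) m"
    if "j < n" "I j m" "m b 0 = j" for j m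
  proof (rule terminates_Seq)
    have "terminates N L ?inc (\<lambda>m. I (Suc j) m \<and> m b 0 = Suc j) m'"
      if "m' b 0 = j \<and> I (Suc j) (m'(b := (m' b)(0 := Suc j)))" for m'
      using that \<open>j < n\<close> n L by (intro terminates_Store) auto
    then show "terminates N L c (terminates N L ?inc (\<lambda>m. I (Suc j) m \<and> m b 0 = Suc j)) m"
      using body[OF that] by (fastforce simp: terminates_def[of N L c])
  qed
  \<comment> \<open>Induction on the remaining rounds; the additional 1 pays for the last evaluation
    of the guard.\<close>
  have loop: "\<exists>t m'. exec (While ?b ?c) m t m' \<and> bounded_memory L m' \<and> I n m' \<and> t \<le> (n - j + 1) * ?T"
    if "j \<le> n" "I j m" "m b 0 = j" "bounded_memory L m" for j m
    using that
  proof (induction "n - j" arbitrary: j m)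
    case 0
    have "bcost ?b m \<le> ?T" using bcost_le[OF 0(5) L, of ?b] by (simp add: distrib_right)
    moreover have "\<not> bval ?b m" using 0 limit by simp
    ultimately show ?case using 0 exec.WhileFalse[of ?b m ?c] by (auto simp del: bcost.simps bval.simps)
  next
    case (Suc d)
    then have j: "j < n" by simp
    obtain t1 m1 where 1: "exec ?c m t1 m1" "bounded_memory L m1" "I (Suc j) m1" "m1 b 0 = Suc j"
      "t1 \<le> poly (cost_poly ?c) N * (L + 2)\<^sup>2"
      using step[OF j Suc(4,5)] Suc(6) unfolding terminates_def by blast
    obtain t2 m2 where 2: "exec (While ?b ?c) m1 t2 m2" "bounded_memory L m2" "I n m2"
      "t2 \<le> (n - Suc j + 1) * ?T"
      using Suc(1)[OF _ _ 1(3,4,2)] Suc(2) j by fastforce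
    have "bval ?b m" using limit[OF Suc(4)] Suc(5) j by simp
    then have ex: "exec (While ?b ?c) m (bcost ?b m + t1 + t2) m2"
      using exec.WhileTrue 1(1) 2(1) by blast
    have "bcost ?b m \<le> bcost_weight ?b * (L + 2)\<^sup>2" by (rule bcost_le[OF Suc(6) L])
    then have "bcost ?b m + t1 + t2 \<le> ?T + (n - Suc j + 1) * ?T"
      using 1(5) 2(4) by (simp only: distrib_right)
    also have "\<dots> = (n - j + 1) * ?T" using j by (simp add: Suc_diff_Suc)
    finally show ?case using ex 2 by blast
  qed
  have "terminates N L (While ?b ?c) Q (m(b := (m b)(0 := 0)))"
    unfolding terminates_def
  proof (intro conjI impI)
    assume "bounded_memory L (m(b := (m b)(0 := 0)))"
    then obtain t m' where t: "exec (While ?b ?c) (m(b := (m b)(0 := 0))) t m'" "bounded_memory L m'"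
      "I n m'" "t \<le> (n + 1) * ?T"
      using loop[of 0 "m(b := (m b)(0 := 0))"] init by auto
    have "(n + 1) * ?T \<le> (N + 1) * ?T" using n by (intro mult_le_mono1) simp
    also have "\<dots> = poly (cost_poly (While ?b ?c)) N * (L + 2)\<^sup>2"
      by (simp only: cost_poly.simps poly_mult poly_add poly_pCons poly_0 mult_zero_right add_0_left add_0_right
          mult_1_right mult.assoc add.commute)
    finally show "\<exists>t m'. exec (While ?b ?c) (m(b := (m b)(0 := 0))) t m' \<and> bounded_memory L m' \<and>
        Q m' \<and> t \<le> poly (cost_poly (While ?b ?c)) N * (L + 2)\<^sup>2"
      using t post by (meson order_trans)
  qed (fact L)
  then show ?thesis
    unfolding For_def by (intro terminates_Seq terminates_Store) (use L in auto)
qed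

section \<open>The kernelization program\<close>

abbreviation num_vertices :: aexp where "num_vertices \<equiv> Load 0 (Const 1)"
abbreviation parameter :: aexp where "parameter \<equiv> Load 0 (Const 2)"

text \<open>In bank 0, cell 0 holds the length, cell 1 the number of vertices and cell 2 the
  parameter, so weights begin at 3 and the matrix at 3 plus the number of vertices.\<close>

definition Weight :: "aexp \<Rightarrow> aexp" where
  "Weight a = Load 0 (Add (Const 3) a)"

definition Adjacent :: "aexp \<Rightarrow> aexp \<Rightarrow> aexp" where
  "Adjacent a a' = Load 0 (Add (Add (Const 3) num_vertices) (Add (Mult a num_vertices) a'))"

text \<open>The absolute difference: one of the two truncated subtractions is 0.\<close>

definition Distance :: "aexp \<Rightarrow> aexp \<Rightarrow> aexp" where
  "Distance a a' = Add (Monus a a') (Monus a' a)"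

text \<open>Indicator of an edge of the complement: 1 minus the adjacency entry, lowered to 0 by the
  second term when both arguments are equal.\<close>

definition Non_adjacent :: "aexp \<Rightarrow> aexp \<Rightarrow> aexp" where
  "Non_adjacent a a' = Monus (Monus (Const 1) (Adjacent a a')) (Monus (Const 1) (Distance a a'))"

text \<open>Orders vertices by weight; since vertex numbers are below \<open>num_vertices\<close>,
  ties are broken by number.\<close>

definition Key :: "aexp \<Rightarrow> aexp" where
  "Key a = Add (Mult (Weight a) num_vertices) a"

definition Positive :: "aexp \<Rightarrow> aexp" where
  "Positive a = Monus (Const 1) (Monus (Const 1) a)"

text \<open>Bank 2 lists the kept vertices and bank 9 holds their number. Banks 3, 4 and 5 are loop counters,
  6 the degree in the complement, 7 the number of heavier twins, 8 the indicator of a heavier twin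
  and 10 the power of two.\<close>

definition count_vertex :: com where
  "count_vertex =
     Seq (Assign 6 (Add (Var 6) (Non_adjacent (Var 3) (Var 4))))
    (Seq (Assign 8 (Positive (Monus (Key (Var 4)) (Key (Var 3)))))
    (Seq (For 5 num_vertices
           (Assign 8 (Monus (Var 8)
             (Distance (Non_adjacent (Var 3) (Var 5)) (Non_adjacent (Var 4) (Var 5))))))
         (Assign 7 (Add (Var 7) (Var 8)))))"

text \<open>Every vertex is written to the next free cell of bank 2, but the count advances only if
  it is kept; otherwise the cell is free for the next vertex.\<close>

definition select_vertices :: com where
  "select_vertices = For 3 num_vertices
    (Seq (Assign 6 (Const 0))
    (Seq (Assign 7 (Const 0))
    (Seq (For 4 num_vertices count_vertex)
    (Seq (Store 2 (Var 9) (Var 3))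
         (Assign 9 (Add (Var 9) (Positive (Monus (Var 6) (Var 7)))))))))"

text \<open>As the parameter is given in binary, \<open>k - 1\<close> doublings could take
  exponential time. The loop runs only once per vertex and doubles in round \<open>j\<close> if
  \<open>1 + j < k\<close>.\<close>

definition compute_power :: com where
  "compute_power =
     Seq (Assign 10 (Const 1))
         (For 3 num_vertices (Assign 10 (Add (Var 10)
           (Mult (Var 10) (Positive (Monus parameter (Add (Const 1) (Var 3))))))))"

text \<open>For a parameter above 1 the output is two isolated vertices of weight 1 with parameter
  1; the four matrix cells are still 0. Otherwise it is the empty graph with parameter 0, read from
  two untouched cells.\<close>

definition write_yes :: com where
  "write_yes = Cond (Less (Const 1) parameter)
     (Seq (Store 1 (Const 0) (Const 8))
     (Seq (Store 1 (Const 1) (Const 2))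
     (Seq (Store 1 (Const 2) (Const 1))
     (Seq (Store 1 (Const 3) (Const 1))
          (Store 1 (Const 4) (Const 1))))))
     (Store 1 (Const 0) (Const 2))"

text \<open>Weights are truncated by \<open>x - (x - k)\<close>, the minimum of \<open>x\<close> and
  \<open>k\<close>.\<close>

definition write_selected :: com where
  "write_selected =
     Seq (Store 1 (Const 0) (Add (Const 2) (Add (Var 9) (Mult (Var 9) (Var 9)))))
    (Seq (Store 1 (Const 1) (Var 9))
    (Seq (Store 1 (Const 2) parameter)
    (Seq (For 3 (Var 9) (Store 1 (Add (Const 3) (Var 3))
           (Monus (Weight (Load 2 (Var 3))) (Monus (Weight (Load 2 (Var 3))) parameter))))
         (For 3 (Var 9) (For 4 (Var 9)
           (Store 1 (Add (Add (Const 3) (Var 9)) (Add (Mult (Var 3) (Var 9)) (Var 4)))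
             (Adjacent (Load 2 (Var 3)) (Load 2 (Var 4)))))))))"

definition kernelize :: com where
  "kernelize = Seq select_vertices (Seq compute_power
     (Cond (Less (Mult (Add (Var 10) (Const 1)) (Monus parameter (Const 1))) (Var 9))
       write_yes write_selected))"

lemma map_upt_add: "map f [0..<a + b] = map f [0..<a] @ map (\<lambda>i. f (a + i)) [0..<b]"
  by (induction b) auto

section \<open>Verification of the program\<close>

text \<open>\<open>N\<close> bounds the loops and \<open>L\<close> the words: \<open>N_less\<close>
  covers counts, the length of the output and the constants written, \<open>pow_le\<close> the power
  of two, \<open>k_le\<close> the parameter and the truncated weights.\<close>

locale dwc_instance =
  fixes n k :: nat and w :: "nat \<Rightarrow> nat" and E :: "(nat \<times> nat) set" and N L :: nat
  assumes n_le: "n \<le> N" and N_less: "N + n * n + 8 \<le> 2 ^ L" and L_pos: "0 < L"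
    and pow_le: "2 ^ n \<le> (2::nat) ^ L"
    and k_le: "k \<le> 2 ^ L"
begin

definition holds_instance :: "memory \<Rightarrow> bool" where
  "holds_instance m \<longleftrightarrow> m 0 1 = n \<and> m 0 2 = k \<and> (\<forall>v<n. m 0 (3 + v) = w v) \<and>
     (\<forall>u<n. \<forall>v<n. m 0 (3 + n + (u * n + v)) = of_bool ((u, v) \<in> E))"

definition key :: "nat \<Rightarrow> nat" where
  "key v = w v * n + v"

definition nonadj :: "nat \<Rightarrow> nat \<Rightarrow> bool" where
  "nonadj u v \<longleftrightarrow> u \<noteq> v \<and> (u, v) \<notin> E"

definition heavier_twin :: "nat \<Rightarrow> nat \<Rightarrow> bool" where
  "heavier_twin v u \<longleftrightarrow> key v < key u \<and> (\<forall>x<n. nonadj v x \<longleftrightarrow> nonadj u x)"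

text \<open>The counts are sums of indicators because the program accumulates them in this way;
  \<open>kept_iff\<close> turns them into cardinalities.\<close>

definition kept :: "nat \<Rightarrow> bool" where
  "kept v \<longleftrightarrow> (\<Sum>u<n. of_bool (heavier_twin v u)) < (\<Sum>u<n. of_bool (nonadj v u) :: nat)"

definition kept_list :: "nat \<Rightarrow> nat list" where
  "kept_list j = filter kept [0..<j]"

lemma holds_instance_upd [simp]: "b \<noteq> 0 \<Longrightarrow> holds_instance (m(b := f)) = holds_instance m"
  by (simp add: holds_instance_def)

lemma le_bound: "x \<le> n \<Longrightarrow> x \<le> 2 ^ L"
  using n_le N_less by linarith

lemma aval_num_vertices: "holds_instance m \<Longrightarrow> aval num_vertices m = n"
  and aval_parameter: "holds_instance m \<Longrightarrow> aval parameter m = k"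
  and aval_Weight: "holds_instance m \<Longrightarrow> aval a m < n \<Longrightarrow> aval (Weight a) m = w (aval a m)"
  and aval_Adjacent: "holds_instance m \<Longrightarrow> aval a m < n \<Longrightarrow> aval a' m < n \<Longrightarrow>
    aval (Adjacent a a') m = of_bool ((aval a m, aval a' m) \<in> E)"
  by (auto simp: holds_instance_def Weight_def Adjacent_def)

lemma aval_Distance_of_bool:
  "aval a m = of_bool P \<Longrightarrow> aval a' m = of_bool Q \<Longrightarrow> aval (Distance a a') m = of_bool (P \<noteq> Q)"
  by (auto simp: Distance_def)

lemma aval_Non_adjacent: "holds_instance m \<Longrightarrow> aval a m < n \<Longrightarrow> aval a' m < n \<Longrightarrow>
    aval (Non_adjacent a a') m = of_bool (nonadj (aval a m) (aval a' m))"
  using aval_Adjacent[of m a a'] by (auto simp: Non_adjacent_def Distance_def nonadj_def)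

lemma aval_Key: "holds_instance m \<Longrightarrow> aval a m < n \<Longrightarrow> aval (Key a) m = key (aval a m)"
  using aval_num_vertices[of m] aval_Weight[of m a] by (simp add: Key_def key_def)

lemma aval_Positive: "aval (Positive a) m = of_bool (0 < aval a m)"
  by (auto simp: Positive_def)

lemma sum_of_bool_le: "(\<Sum>u<j. of_bool (P u)) \<le> (j::nat)"
  by (induction j) auto

text \<open>Bank 1 must still be zero, as \<open>write_yes\<close> relies on untouched
  cells.\<close>

definition selected :: "nat \<Rightarrow> memory \<Rightarrow> bool" where
  "selected j m \<longleftrightarrow> holds_instance m \<and> m 1 = (\<lambda>_. 0) \<and> m 9 0 = length (kept_list j) \<and>
     (\<forall>i<length (kept_list j). m 2 i = kept_list j ! i)"

lemma selected_upd [simp]: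
  "b \<notin> {0, 1, 2, 9} \<Longrightarrow> selected j (m(b := f)) = selected j m"
  by (simp add: selected_def)

lemma selectedD: "selected j m \<Longrightarrow> holds_instance m"
  by (simp add: selected_def)

definition counted :: "nat \<Rightarrow> nat \<Rightarrow> memory \<Rightarrow> bool" where
  "counted v u m \<longleftrightarrow> selected v m \<and> m 3 0 = v \<and> m 6 0 = (\<Sum>x<u. of_bool (nonadj v x)) \<and>
     m 7 0 = (\<Sum>x<u. of_bool (heavier_twin v x))"

lemma terminates_count_vertex:
  assumes m: "counted v u m" "m 4 0 = u" and uv: "u < n" "v < n"
  shows "terminates N L count_vertex (\<lambda>m. m 4 0 = u \<and> counted v (Suc u) (m(4 := (m 4)(0 := Suc u)))) m"
proof -
  \<comment> \<open>Bank 6 already counts \<open>u\<close>, bank 7 does not yet. Bank 8 starts as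
    the comparison of keys, and the first position where the non-neighbourhoods differ makes it 0
    for good.\<close>
  let ?I = "\<lambda>x m. selected v m \<and> m 3 0 = v \<and> m 4 0 = u \<and> m 6 0 = (\<Sum>x<Suc u. of_bool (nonadj v x)) \<and>
     m 7 0 = (\<Sum>x<u. of_bool (heavier_twin v x)) \<and>
     m 8 0 = of_bool (key v < key u \<and> (\<forall>y<x. nonadj v y \<longleftrightarrow> nonadj u y))"
  have sel: "holds_instance m" "m 3 0 = v" using m by (auto simp: counted_def selected_def)
  have sum_le: "(\<Sum>x<u. of_bool (P x)) + of_bool (P u) \<le> (2::nat) ^ L" for P
    using sum_of_bool_le[of P "Suc u"] uv le_bound[of "Suc u"] unfolding sum.lessThan_Suc by linarith
  show ?thesis
    unfolding count_vertex_def
  proof (intro terminates_Seq terminates_Store L_pos, goal_cases)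
    case 1
    then show ?case using m sel uv sum_le[of "nonadj v"] by (simp add: aval_Non_adjacent counted_def)
  next
    case 2
    then show ?case using le_bound[of 1] uv by (simp add: aval_Positive)
  next
    case 3
    show ?case
    proof (rule terminates_For[where I = ?I and n = n], goal_cases)
      case 4
      then show ?case using m sel uv
        by (simp add: aval_Non_adjacent aval_Key aval_Positive counted_def)
    next
      case (5 j m)
      then show ?case using aval_num_vertices selectedD by blast
    next
      case (6 j m)
      then have h: "holds_instance m" by (simp add: selected_def)
      have "aval (Monus (Var 8) (Distance (Non_adjacent (Var 3) (Var 5)) (Non_adjacent (Var 4) (Var 5)))) m
          = of_bool (key v < key u \<and> (\<forall>y<Suc j. nonadj v y \<longleftrightarrow> nonadj u y))"
        using 6 uv aval_Distance_of_bool[OF aval_Non_adjacent[OF h, of "Var 3" "Var 5"]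
            aval_Non_adjacent[OF h, of "Var 4" "Var 5"]]
        by (auto simp: less_Suc_eq)
      then show ?case using 6 le_bound[of 1] uv
        by (intro terminates_Store L_pos) auto
    next
      case (7 m')
      then show ?case using sum_le[of "heavier_twin v"]
        by (intro terminates_Store L_pos) (auto simp: counted_def heavier_twin_def)
    qed (use L_pos n_le le_bound in auto)
  qed
qed

lemma terminates_select_vertices:
  assumes "selected 0 m"
  shows "terminates N L select_vertices (selected n) m"
  unfolding select_vertices_def
proof (rule terminates_For[where I = selected and n = n], goal_cases)
  case (6 v m)
  let ?post = "\<lambda>m. m 3 0 = v \<and> selected (Suc v) (m(3 := (m 3)(0 := Suc v)))"
  have fin: "terminates N L (Seq (Store 2 (Var 9) (Var 3))
      (Assign 9 (Add (Var 9) (Positive (Monus (Var 6) (Var 7)))))) ?post m'"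
    if c: "counted v n m'" for m'
  proof (intro terminates_Seq terminates_Store L_pos)
    have len: "length (kept_list v) \<le> v" unfolding kept_list_def
      using length_filter_le[of kept "[0..<v]"] by simp
    have kept: "kept v \<longleftrightarrow> m' 7 0 < m' 6 0" using c by (simp add: counted_def kept_def)
    have len': "length (kept_list v) + of_bool (kept v) \<le> 2 ^ L"
      using len 6(1) le_bound[of "Suc v"] by (auto simp: of_bool_def)
    show "aval (Var 3) m' \<le> 2 ^ L" using c 6 le_bound by (simp add: counted_def)
    let ?m = "m'(2 := (m' 2)(aval (Var 9) m' := aval (Var 3) m'))"
    have val: "aval (Add (Var 9) (Positive (Monus (Var 6) (Var 7)))) ?m = length (kept_list v) + of_bool (kept v)"
      using c kept by (simp add: aval_Positive counted_def selected_def)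
    then show "aval (Add (Var 9) (Positive (Monus (Var 6) (Var 7)))) ?m \<le> 2 ^ L" using len' by simp
    show "?post (?m(9 := (?m 9)(aval (Const 0) ?m := aval (Add (Var 9) (Positive (Monus (Var 6) (Var 7)))) ?m)))"
      unfolding val using c by (auto simp: counted_def selected_def kept_list_def nth_append less_Suc_eq)
  qed
  show ?case
  proof (intro terminates_Seq terminates_Store L_pos, goal_cases)
    case 3
    show ?case
    proof (rule terminates_For[where I = "counted v" and n = n], goal_cases)
      case 4
      then show ?case using \<open>selected v m\<close> \<open>m 3 0 = v\<close> by (simp add: counted_def)
    next
      case (5 j m)
      then show ?case using aval_num_vertices selectedD by (blast intro: counted_def[THEN iffD1, THEN conjunct1])
    next
      case (6 u m)
      then show ?case using terminates_count_vertex \<open>v < n\<close> by blast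
    next
      case (7 m)
      then show ?case using fin[of m] by (simp add: terminates_def) 
    qed (use L_pos n_le le_bound in auto)
  qed auto
qed (use assms L_pos n_le le_bound aval_num_vertices selectedD in auto)

lemma terminates_compute_power:
  assumes "selected n m"
  shows "terminates N L compute_power (\<lambda>m. selected n m \<and> m 10 0 = 2 ^ min n (k - 1)) m"
  unfolding compute_power_def
proof (intro terminates_Seq terminates_Store L_pos, goal_cases)
  case 2
  show ?case
  proof (rule terminates_For[where I = "\<lambda>j m. selected n m \<and> m 10 0 = 2 ^ min j (k - 1)" and n = n],
      goal_cases)
    case (6 j m)
    have "aval (Add (Var 10) (Mult (Var 10) (Positive (Monus parameter (Add (Const 1) (Var 3)))))) m
        = 2 ^ min (Suc j) (k - 1)"
      using 6 aval_parameter[OF selectedD, of n m] by (auto simp: aval_Positive min_def not_le le_less_Suc_eq)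
    moreover have "(2::nat) ^ min (Suc j) (k - 1) \<le> 2 ^ n" using 6(1) by (intro power_increasing) auto
    then have "(2::nat) ^ min (Suc j) (k - 1) \<le> 2 ^ L" using pow_le by linarith
    ultimately show ?case using 6 by (intro terminates_Store L_pos) auto
  qed (use assms L_pos n_le le_bound aval_num_vertices selectedD in auto)
qed simp

text \<open>The matrix is indexed by a single row-major position, as its cells are addressed;
  \<open>encode_flat\<close> puts \<open>encode\<close> in the same form.\<close>

definition reduced_encoding :: "nat list" where
  "reduced_encoding = (let ks = kept_list n; l = length ks in
     [l, k] @ map (\<lambda>j. min k (w (ks ! j))) [0..<l] @
     map (\<lambda>q. of_bool ((ks ! (q div l), ks ! (q mod l)) \<in> E)) [0..<l * l])"

lemma length_kept_list: "length (kept_list n) \<le> n"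
  unfolding kept_list_def using length_filter_le[of kept "[0..<n]"] by simp

lemma kept_list_less: "i < length (kept_list n) \<Longrightarrow> kept_list n ! i < n"
  using nth_mem[of i "kept_list n"] by (auto simp: kept_list_def)

text \<open>Three nested invariants: \<open>base\<close> for the header and the selection,
  \<open>weights\<close>, and \<open>matrix\<close>, which counts written entries in row-major order
  and so serves both the loop over rows and the loop over columns.\<close>

lemma terminates_write_selected:
  assumes m: "selected n m"
  shows "terminates N L write_selected (\<lambda>m. output_words m = reduced_encoding) m"
proof -
  define ks where "ks = kept_list n"
  define l where "l = length ks"
  define base where "base m \<longleftrightarrow> holds_instance m \<and> m 9 0 = l \<and> (\<forall>i<l. m 2 i = ks ! i) \<and>
    m 1 0 = 2 + l + l * l \<and> m 1 1 = l \<and> m 1 2 = k" for m :: memory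
  define weights where "weights j m \<longleftrightarrow> base m \<and> (\<forall>i<j. m 1 (3 + i) = min k (w (ks ! i)))" for j and m :: memory
  define matrix where "matrix j m \<longleftrightarrow> weights l m \<and>
    (\<forall>q<j. m 1 (3 + l + q) = of_bool ((ks ! (q div l), ks ! (q mod l)) \<in> E))" for j and m :: memory
  have base_upd [simp]: "b \<notin> {0, 1, 2, 9} \<Longrightarrow> base (m(b := f)) = base m" for m b f
    by (simp add: base_def)
  have weights_upd [simp]: "b \<notin> {0, 1, 2, 9} \<Longrightarrow> weights j (m(b := f)) = weights j m" for m b f j
    by (simp add: weights_def)
  have matrix_upd [simp]: "b \<notin> {0, 1, 2, 9} \<Longrightarrow> matrix j (m(b := f)) = matrix j m" for m b f j
    by (simp add: matrix_def)
  have l: "l \<le> n" using length_kept_list by (simp add: l_def ks_def)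
  have ks: "ks ! i < n" if "i < l" for i using that kept_list_less by (simp add: l_def ks_def)
  have "2 + (l + l * l) \<le> 2 + (n + n * n)" using l by (intro add_mono mult_mono) auto
  then have len: "2 + (l + l * l) \<le> 2 ^ L" using N_less n_le by linarith
  have limit: "aval (Var 9) m = l" if "base m" for m using that by (simp add: base_def)
  have out: "output_words m = reduced_encoding" if "matrix (l * l) m" for m
  proof -
    have c: "m 1 0 = 2 + (l + l * l)" "m 1 1 = l" "m 1 2 = k"
      "\<And>i. i < l \<Longrightarrow> m 1 (3 + i) = min k (w (ks ! i))"
      "\<And>q. q < l * l \<Longrightarrow> m 1 (3 + l + q) = of_bool ((ks ! (q div l), ks ! (q mod l)) \<in> E)"
      using that by (auto simp: matrix_def weights_def base_def)
    have "output_words m = map (\<lambda>i. m 1 (Suc i)) [0..<2] @ map (\<lambda>i. m 1 (3 + i)) [0..<l] @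
        map (\<lambda>q. m 1 (3 + l + q)) [0..<l * l]"
      unfolding output_words_def c(1) map_upt_add by (simp add: numeral_3_eq_3)
    also have "map (\<lambda>i. m 1 (Suc i)) [0..<2] = [l, k]"
      using c(2,3) by (simp add: upt_rec numeral_2_eq_2)
    also have "map (\<lambda>i. m 1 (3 + i)) [0..<l] = map (\<lambda>j. min k (w (ks ! j))) [0..<l]"
      using c(4) by (intro map_cong) auto
    also have "map (\<lambda>q. m 1 (3 + l + q)) [0..<l * l] =
        map (\<lambda>q. of_bool ((ks ! (q div l), ks ! (q mod l)) \<in> E)) [0..<l * l]"
      using c(5) by (intro map_cong) auto
    finally show ?thesis by (simp add: reduced_encoding_def Let_def ks_def l_def)
  qed
  have inner: "terminates N L
      (For 4 (Var 9) (Store 1 (Add (Add (Const 3) (Var 9)) (Add (Mult (Var 3) (Var 9)) (Var 4)))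
             (Adjacent (Load 2 (Var 3)) (Load 2 (Var 4)))))
      (\<lambda>m. m 3 0 = i \<and> matrix (Suc i * l) (m(3 := (m 3)(0 := Suc i)))) m"
    if i: "i < l" "matrix (i * l) m" "m 3 0 = i" for i m
  proof (rule terminates_For[where I = "\<lambda>j m. m 3 0 = i \<and> matrix (i * l + j) m" and n = l], goal_cases)
    case (6 j m)
    then have b: "base m" by (simp add: matrix_def weights_def)
    then have "aval (Adjacent (Load 2 (Var 3)) (Load 2 (Var 4))) m
        = of_bool ((ks ! i, ks ! j) \<in> E)"
      using 6 i ks aval_Adjacent[of m "Load 2 (Var 3)" "Load 2 (Var 4)"] by (simp add: base_def)
    moreover have "(i * l + j) div l = i" "(i * l + j) mod l = j" using 6(1) by auto
    ultimately show ?case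
      using 6 b le_bound[of 1] i l
      by (intro terminates_Store L_pos) (auto simp: matrix_def weights_def base_def less_Suc_eq)
  qed (use i l L_pos n_le le_bound limit in \<open>auto simp: add.commute matrix_def weights_def\<close>)
  have adj: "terminates N L
      (For 3 (Var 9) (For 4 (Var 9) (Store 1 (Add (Add (Const 3) (Var 9)) (Add (Mult (Var 3) (Var 9)) (Var 4)))
             (Adjacent (Load 2 (Var 3)) (Load 2 (Var 4))))))
      (\<lambda>m. output_words m = reduced_encoding) m" if "weights l m" for m
  proof (rule terminates_For[where I = "\<lambda>i m. matrix (i * l) m" and n = l], goal_cases)
    case (6 i m)
    then show ?case using inner by blast
  qed (use that l L_pos n_le le_bound limit out in \<open>auto simp: matrix_def weights_def\<close>)
  have wts: "terminates N L
      (For 3 (Var 9) (Store 1 (Add (Const 3) (Var 3))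
           (Monus (Weight (Load 2 (Var 3))) (Monus (Weight (Load 2 (Var 3))) parameter))))
      (weights l) m" if "base m" for m
  proof (rule terminates_For[where I = weights and n = l], goal_cases)
    case (6 j m)
    then have b: "base m" by (simp add: weights_def)
    then have v: "aval (Monus (Weight (Load 2 (Var 3))) (Monus (Weight (Load 2 (Var 3))) parameter)) m
        = min k (w (ks ! j))"
      using 6 ks[of j] aval_Weight[of m "Load 2 (Var 3)"] aval_parameter[of m] by (simp add: base_def)
    moreover have "min k (w (ks ! j)) \<le> 2 ^ L" using k_le by simp
    ultimately show ?case
      using 6 b by (intro terminates_Store L_pos) (auto simp: weights_def base_def less_Suc_eq)
  qed (use that l L_pos n_le le_bound limit in \<open>auto simp: weights_def\<close>)
  show ?thesis
    unfolding write_selected_def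
  proof (intro terminates_Seq terminates_Store L_pos, goal_cases)
    case 4
    show ?case
    proof (rule terminates_weaken[OF wts], goal_cases)
      case 1
      then show ?case using m selectedD[OF m]
        by (simp add: base_def selected_def ks_def l_def holds_instance_def)
    next
      case 2
      then show ?case by (rule adj)
    qed
  qed (use m len l le_bound k_le aval_parameter[OF selectedD[OF m]] in
      \<open>auto simp: selected_def ks_def[symmetric] l_def[symmetric]\<close>)
qed

lemma terminates_write_yes:
  assumes m: "selected n m"
  shows "terminates N L write_yes
    (\<lambda>m. output_words m = (if 1 < k then [2, 1, 1, 1, 0, 0, 0, 0] else [0, 0])) m"
proof -
  have k: "m 0 2 = k" and m1: "m 1 = (\<lambda>_. 0)" using m by (auto simp: selected_def holds_instance_def)
  have le: "c \<le> 2 ^ L" if "c \<le> 8" for c :: nat using N_less that by linarith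
  show ?thesis
    unfolding write_yes_def
    by (intro terminates_Cond terminates_Seq terminates_Store L_pos)
      (use k m1 le in \<open>auto simp: output_words_def upt_rec\<close>)
qed

definition kernel_encoding :: "nat list" where
  "kernel_encoding =
    (if (2 ^ (k - 1) + 1) * (k - 1) < length (kept_list n)
     then if 1 < k then [2, 1, 1, 1, 0, 0, 0, 0] else [0, 0] else reduced_encoding)"

lemma terminates_kernel:
  assumes m: "selected 0 m"
  shows "terminates N L kernelize (\<lambda>m. output_words m = kernel_encoding) m"
proof -
  let ?l = "length (kept_list n)"
  \<comment> \<open>Stopping the power at \<open>n\<close> doublings does not affect the test: if
    \<open>k - 1\<close> exceeds \<open>n\<close>, both products are at least \<open>k - 1\<close>
    and hence above the number of kept vertices.\<close>
  have small: "(2 ^ min n (k - 1) + 1) * (k - 1) < ?l \<longleftrightarrow> (2 ^ (k - 1) + 1) * (k - 1) < ?l"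
  proof (cases "k - 1 \<le> n")
    case False
    have "?l \<le> (x + 1) * (k - 1)" for x
    proof -
      have "?l \<le> 1 * (k - 1)" using False length_kept_list by linarith
      also have "\<dots> \<le> (x + 1) * (k - 1)" by (intro mult_le_mono1) simp
      finally show ?thesis .
    qed
    then show ?thesis by (meson leD)
  qed (simp add: min_absorb2)
  have "terminates N L (Cond (Less (Mult (Add (Var 10) (Const 1)) (Monus parameter (Const 1))) (Var 9))
       write_yes write_selected) (\<lambda>m. output_words m = kernel_encoding) m"
    if "selected n m \<and> m 10 0 = 2 ^ min n (k - 1)" for m
  proof (rule terminates_Cond[OF L_pos])
    have b: "bval (Less (Mult (Add (Var 10) (Const 1)) (Monus parameter (Const 1))) (Var 9)) m \<longleftrightarrow>
      (2 ^ (k - 1) + 1) * (k - 1) < ?l"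
      unfolding small[symmetric] using that by (simp add: selected_def holds_instance_def)
    show "terminates N L write_yes (\<lambda>m. output_words m = kernel_encoding) m"
      if "bval (Less (Mult (Add (Var 10) (Const 1)) (Monus parameter (Const 1))) (Var 9)) m"
      using terminates_write_yes[of m] \<open>selected n m \<and> _\<close> that[unfolded b]
      by (simp add: kernel_encoding_def)
    show "terminates N L write_selected (\<lambda>m. output_words m = kernel_encoding) m"
      if "\<not> bval (Less (Mult (Add (Var 10) (Const 1)) (Monus parameter (Const 1))) (Var 9)) m"
      using terminates_write_selected[of m] \<open>selected n m \<and> _\<close> that[unfolded b]
      by (simp add: kernel_encoding_def)
  qed
  then have "terminates N L (Seq compute_power
     (Cond (Less (Mult (Add (Var 10) (Const 1)) (Monus parameter (Const 1))) (Var 9))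
       write_yes write_selected)) (\<lambda>m. output_words m = kernel_encoding) m" if "selected n m" for m
    by (rule terminates_Seq[OF terminates_weaken[OF terminates_compute_power[OF that]]])
  then show ?thesis
    unfolding kernelize_def by (rule terminates_Seq[OF terminates_weaken[OF terminates_select_vertices[OF m]]])
qed

end

section \<open>Encodings and correctness\<close>

lemma concat_map_upt:
  "concat (map (\<lambda>u. map (f u) [0..<n]) [0..<j]) = map (\<lambda>q. f (q div n) (q mod n)) [0..<j * n]"
proof (induction j)
  case (Suc j)
  have "map (\<lambda>q. f (q div n) (q mod n)) [0..<Suc j * n] =
      map (\<lambda>q. f (q div n) (q mod n)) [0..<j * n] @
      map (\<lambda>i. f ((j * n + i) div n) ((j * n + i) mod n)) [0..<n]"
    using map_upt_add[of "\<lambda>q. f (q div n) (q mod n)" "j * n" n] by (simp add: add.commute)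
  also have "map (\<lambda>i. f ((j * n + i) div n) ((j * n + i) mod n)) [0..<n] = map (f j) [0..<n]"
    by (intro map_cong) auto
  finally show ?case using Suc by simp
qed simp

lemma encode_flat:
  "encode G w k = (let n = card (pverts G) in
     [n, k] @ map w [0..<n] @ map (\<lambda>q. of_bool ((q div n, q mod n) \<in> parcs G)) [0..<n * n])"
  by (simp add: encode_def concat_map_upt Let_def of_bool_def)

lemma length_encode: "length (encode G w k) = 2 + card (pverts G) + card (pverts G) * card (pverts G)"
  by (simp add: encode_flat Let_def)

lemma word_size_le_Suc: "word_size x \<le> x + 1"
  using floorlog_leI[of x 2 x] less_exp[of x] by (simp add: word_size_def)

lemma words_size_le:
  assumes "\<And>x. x \<in> set xs \<Longrightarrow> word_size x \<le> b"
  shows "words_size xs \<le> length xs * b"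
  using assms unfolding words_size_def by (induction xs) (auto intro!: add_mono)

text \<open>A crude bound suffices for a function of the parameter, so the length of a word is
  replaced by its value plus 1.\<close>

lemma words_size_encode_le:
  assumes n: "card (pverts G) \<le> B" and k: "k \<le> K" and w: "\<And>v. v < card (pverts G) \<Longrightarrow> w v \<le> K"
  shows "words_size (encode G w k) \<le> (2 + B + B * B) * (B + K + 2)"
proof -
  have "words_size (encode G w k) \<le> length (encode G w k) * (B + K + 2)"
  proof (rule words_size_le)
    fix x assume "x \<in> set (encode G w k)"
    then have "x \<le> B + K + 1" using n k w by (force simp: encode_flat Let_def of_bool_def)
    then show "word_size x \<le> B + K + 2" using word_size_le_Suc[of x] by linarith
  qed
  also have "\<dots> \<le> (2 + B + B * B) * (B + K + 2)"
    unfolding length_encode using n by (intro mult_le_mono1 add_mono mult_mono) auto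
  finally show ?thesis .
qed

lemma length_le_words_size: "length xs \<le> words_size xs"
  unfolding words_size_def by (induction xs) (auto simp: word_size_def)

lemma mem_less_power_words_size: "x \<in> set xs \<Longrightarrow> x < 2 ^ words_size xs"
proof -
  assume "x \<in> set xs"
  then have "word_size x \<le> words_size xs" unfolding words_size_def by (intro member_le_sum_list) auto
  then show ?thesis by (intro floorlog_leD) (auto simp: word_size_def)
qed

lemma bounded_input_memory:
  "bounded_memory (words_size xs + 8) (input_memory xs)"
proof -
  let ?N = "words_size xs"
  have "length xs < 2 ^ ?N" using length_le_words_size[of xs] less_exp[of ?N] by linarith
  then have "x < 2 ^ ?N" if "x \<in> set (length xs # xs)" for x
    using that mem_less_power_words_size[of x xs] by auto
  then have "input_memory xs b i \<le> 2 ^ ?N" for b i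
    by (auto simp: input_memory_def less_Suc_eq_le dest!: nth_mem[of i "length xs # xs", simplified] intro: less_imp_le)
  moreover have "(2::nat) ^ ?N \<le> 2 ^ (?N + 8)" by (intro power_increasing) auto
  ultimately show ?thesis unfolding bounded_memory_def by (meson order_trans)
qed

text \<open>The 8 additional bits give a factor 256, enough for the sum of \<open>N\<close>,
  \<open>n * n\<close> and 8; here \<open>n * n\<close> is at most \<open>N\<close> because every
  matrix entry has positive size.\<close>

lemma dwc_instance_encode:
  fixes G w k
  defines "n \<equiv> card (pverts G)" and "N \<equiv> words_size (encode G w k)"
  shows "dwc_instance n k N (N + 8)"
proof
  have len: "2 + n + n * n \<le> N"
    using length_le_words_size[of "encode G w k"] by (simp add: length_encode n_def N_def)
  then show "n \<le> N" by simp
  have "N < 2 ^ N" by (rule less_exp)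
  then have "N + n * n + 8 \<le> 2 ^ N * 256" using len by linarith
  then show "N + n * n + 8 \<le> 2 ^ (N + 8)" by (simp add: power_add)
  show "(2::nat) ^ n \<le> 2 ^ (N + 8)" using len by (intro power_increasing) auto
  have le: "x \<le> 2 ^ (N + 8)" if "x \<in> set (encode G w k)" for x
  proof -
    have "(2::nat) ^ N \<le> 2 ^ (N + 8)" by (intro power_increasing) auto
    then show ?thesis using mem_less_power_words_size[OF that] unfolding N_def by linarith
  qed
  show "k \<le> 2 ^ (N + 8)" by (rule le) (simp add: encode_flat Let_def)
qed simp

lemma row_major_less: "(u::nat) < n \<Longrightarrow> v < n \<Longrightarrow> u * n + v < n * n"
proof -
  assume "u < n" "v < n"
  then have "u * n + v < Suc u * n" "Suc u * n \<le> n * n" by (simp, intro mult_le_mono1) auto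
  then show ?thesis by linarith
qed

lemma input_memory_encode:
  fixes G w k
  defines "n \<equiv> card (pverts G)" and "m \<equiv> input_memory (encode G w k)"
  shows "m 0 1 = n" "m 0 2 = k" "v < n \<Longrightarrow> m 0 (3 + v) = w v"
    "u < n \<Longrightarrow> v < n \<Longrightarrow> m 0 (3 + n + (u * n + v)) = of_bool ((u, v) \<in> parcs G)"
    "b \<noteq> 0 \<Longrightarrow> m b = (\<lambda>_. 0)"
proof -
  have cell: "m 0 (Suc i) = encode G w k ! i" if "i < 2 + n + n * n" for i
    using that by (simp add: m_def input_memory_def length_encode n_def)
  have nth: "encode G w k ! 0 = n" "encode G w k ! 1 = k"
    "v < n \<Longrightarrow> encode G w k ! (2 + v) = w v"
    "q < n * n \<Longrightarrow> encode G w k ! (2 + n + q) = of_bool ((q div n, q mod n) \<in> parcs G)" for q v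
    by (auto simp: encode_flat Let_def n_def nth_append)
  show "m 0 1 = n" "m 0 2 = k" using cell[of 0] cell[of 1] nth by (auto simp: numeral_2_eq_2)
  show "v < n \<Longrightarrow> m 0 (3 + v) = w v" using cell[of "2 + v"] nth(3)[of v] by (simp add: numeral_3_eq_3)
  show "m 0 (3 + n + (u * n + v)) = of_bool ((u, v) \<in> parcs G)" if "u < n" "v < n"
  proof -
    have "m 0 (Suc (2 + n + (u * n + v))) =
        of_bool (((u * n + v) div n, (u * n + v) mod n) \<in> parcs G)"
      using cell[of "2 + n + (u * n + v)"] nth(4)[of "u * n + v"] row_major_less[OF that] by simp
    then show ?thesis using that by (simp add: numeral_3_eq_3)
  qed
  show "b \<noteq> 0 \<Longrightarrow> m b = (\<lambda>_. 0)" by (auto simp: m_def input_memory_def)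
qed

lemma weighted_graphI:
  assumes "finite V" "E \<subseteq> V \<times> V" "irrefl E" "sym E" "\<And>v. v \<in> V \<Longrightarrow> 0 < w v"
  shows "weighted_graph \<lparr>pverts = V, parcs = E\<rparr> w"
proof -
  have "finite E" using assms(1,2) by (meson finite_SigmaI finite_subset)
  then have "pair_graph \<lparr>pverts = V, parcs = E\<rparr>"
    using assms by unfold_locales (auto simp: symmetric_def irrefl_def)
  then show ?thesis using assms(5) by (simp add: weighted_graph_def)
qed

lemma weighted_graphD:
  assumes "weighted_graph G w"
  shows "finite (pverts G)" "irrefl (parcs G)" "sym (parcs G)" "\<And>v. v \<in> pverts G \<Longrightarrow> 0 < w v"
proof -
  interpret pair_graph G using assms by (simp add: weighted_graph_def)
  show "finite (pverts G)" "irrefl (parcs G)" "sym (parcs G)"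
    using pair_finite_verts pair_no_loops pair_sym_arcs by (force simp: irrefl_def symmetric_def)+
  show "\<And>v. v \<in> pverts G \<Longrightarrow> 0 < w v" using assms by (simp add: weighted_graph_def)
qed

section \<open>Equivalence and size of the kernel\<close>

context dwc_instance
begin

lemma sum_of_bool_eq_card: "(\<Sum>u<n. of_bool (P u)) = card {u \<in> {..<n}. P u}"
  by (simp add: Int_def)

lemma nonadj_eq_iff: "(\<forall>x<n. nonadj v x \<longleftrightarrow> nonadj u x) \<longleftrightarrow>
    non_neighbours E {..<n} u = non_neighbours E {..<n} v"
  unfolding nonadj_def non_neighbours_def set_eq_iff mem_Collect_eq lessThan_iff
  by (intro arg_cong[of _ _ All] ext) auto

lemma kept_iff: "kept v \<longleftrightarrow>
    card {u \<in> {..<n}. non_neighbours E {..<n} u = non_neighbours E {..<n} v \<and> key v < key u}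
      < card (non_neighbours E {..<n} v)"
proof -
  have "{u \<in> {..<n}. nonadj v u} = non_neighbours E {..<n} v"
    by (auto simp: nonadj_def non_neighbours_def)
  then show ?thesis
    unfolding kept_def sum_of_bool_eq_card heavier_twin_def nonadj_eq_iff by (simp add: conj_commute)
qed

lemma set_kept_list: "set (kept_list n) = {v \<in> {..<n}. kept v}"
  by (auto simp: kept_list_def)

text \<open>If \<open>w u < w v\<close>, then \<open>key v\<close> is at least
  \<open>(w u + 1) * n\<close>, which exceeds \<open>key u\<close> because
  \<open>u < n\<close>.\<close>

lemma key_less_imp_weight_le: "u < n \<Longrightarrow> key v < key u \<Longrightarrow> w v \<le> w u"
proof (rule ccontr)
  assume "u < n" "key v < key u" "\<not> w v \<le> w u"
  then have "Suc (w u) * n \<le> w v * n" by (intro mult_le_mono1) simp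
  then show False using \<open>u < n\<close> \<open>key v < key u\<close> by (simp add: key_def)
qed

lemma inj_on_key: "inj_on key {..<n}"
proof (rule inj_onI)
  fix u v assume "u \<in> {..<n}" "v \<in> {..<n}" "key u = key v"
  then have "(w u * n + u) mod n = (w v * n + v) mod n" by (simp add: key_def)
  then show "u = v" using \<open>u \<in> {..<n}\<close> \<open>v \<in> {..<n}\<close> by simp
qed

lemma saves_kept_iff:
  assumes "sym E" "irrefl E"
  shows "saves E w (set (kept_list n)) k \<longleftrightarrow> saves E w {..<n} k"
proof -
  have "set (kept_list n) = {..<n} - {v \<in> {..<n}. \<not> kept v}" by (auto simp: set_kept_list)
  moreover have "saves E w ({..<n} - {v \<in> {..<n}. \<not> kept v}) k \<longleftrightarrow> saves E w {..<n} k"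
    by (rule saves_delete_light_twins[where key = key])
      (use assms key_less_imp_weight_le in \<open>auto simp: kept_iff not_less\<close>)
  ultimately show ?thesis by simp
qed

text \<open>All other members of the class are heavier twins of the one with the smallest key; since
  that one is kept, there are fewer than \<open>card T\<close> of them.\<close>

lemma card_kept_class_le:
  "card {v \<in> set (kept_list n). non_neighbours E {..<n} v = T} \<le> card T"
proof -
  let ?C = "{v \<in> set (kept_list n). non_neighbours E {..<n} v = T}"
  show ?thesis
  proof (cases "?C = {}")
    case False
    let ?v = "arg_min_on key ?C"
    have v: "?v \<in> ?C" using False by (intro arg_min_if_finite) auto
    have least: "key ?v \<le> key u" if "u \<in> ?C" for u
      using that False by (intro arg_min_least) auto
    let ?H = "{u \<in> {..<n}. non_neighbours E {..<n} u = non_neighbours E {..<n} ?v \<and> key ?v < key u}"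
    have "?C - {?v} \<subseteq> ?H"
    proof
      fix u assume u: "u \<in> ?C - {?v}"
      then have "key u \<noteq> key ?v" using v inj_on_key by (auto simp: set_kept_list inj_on_def)
      then have "key ?v < key u" using least[of u] u by auto
      then show "u \<in> ?H" using u v by (auto simp: set_kept_list)
    qed
    then have "card (?C - {?v}) \<le> card ?H" by (intro card_mono) auto
    also have "\<dots> < card T" using v by (auto simp: set_kept_list kept_iff)
    finally show ?thesis using v by (simp add: card_Diff_singleton)
  qed (simp only: card.empty)
qed

lemma saves_if_many_kept:
  assumes "sym E" "irrefl E" "\<And>v. v < n \<Longrightarrow> 0 < w v"
    and "(2 ^ (k - 1) + 1) * (k - 1) < length (kept_list n)"
  shows "saves E w {..<n} k"
proof (rule ccontr)
  assume "\<not> saves E w {..<n} k"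
  then have "card (set (kept_list n)) \<le> (2 ^ (k - 1) + 1) * (k - 1)"
    by (rule card_le_if_not_saves[rotated 4])
      (use assms card_kept_class_le in \<open>auto simp: set_kept_list\<close>)
  moreover have "distinct (kept_list n)" by (simp add: kept_list_def)
  ultimately show False using assms(4) by (simp add: distinct_card)
qed

lemma kernel_encoding_correct:
  assumes E: "sym E" "irrefl E" and w: "\<And>v. v < n \<Longrightarrow> 0 < w v" and k: "0 < k"
  shows "\<exists>G' w' k'. kernel_encoding = encode G' w' k' \<and> weighted_graph G' w' \<and> standard_vertices G' \<and>
    (2 \<le> k \<longrightarrow> 0 < k') \<and> (dual_weighted_coloring G' w' k' \<longleftrightarrow> saves E w {..<n} k) \<and>
    card (pverts G') \<le> (2 ^ (k - 1) + 1) * (k - 1) \<and> k' \<le> k \<and> (\<forall>v<card (pverts G'). w' v \<le> k)"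
proof (cases "(2 ^ (k - 1) + 1) * (k - 1) < length (kept_list n)")
  case many: True
  have yes: "saves E w {..<n} k" using saves_if_many_kept E w many by blast
  show ?thesis
  proof (cases "1 < k")
    case True
    let ?G = "\<lparr>pverts = {..<2::nat}, parcs = {}\<rparr>"
    have G: "weighted_graph ?G (\<lambda>_. 1)" by (rule weighted_graphI) (auto simp: irrefl_def sym_def)
    \<comment> \<open>Put into one color, the two vertices save 1.\<close>
    have "saves {} (\<lambda>_. 1) {..<2::nat} 1"
      unfolding saves_def
      by (intro exI[of _ "{{..<2}}"])
        (simp add: partition_on_space lessThan_empty_iff edge_free_def coloring_weight_def
          color_weight_def image_constant_conv)
    then have "dual_weighted_coloring ?G (\<lambda>_. 1) 1" using dual_weighted_coloring_iff_saves[OF G] by simp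
    moreover have "kernel_encoding = encode ?G (\<lambda>_. 1) 1"
      using many True by (simp add: kernel_encoding_def encode_flat upt_rec)
    \<comment> \<open>The smallest bound in this case, at \<open>k = 2\<close>, is 3, so two
      vertices are allowed.\<close>
    moreover have "(2 + 1) * 1 \<le> (2 ^ (k - 1) + 1) * (k - 1)"
      using True power_increasing[of 1 "k - 1" "2::nat"] by (intro mult_le_mono add_mono) auto
    ultimately show ?thesis using G yes True
      by (intro exI[of _ ?G] exI[of _ "\<lambda>_. 1"] exI[of _ 1]) (auto simp: standard_vertices_def)
  next
    case False
    \<comment> \<open>Here \<open>k = 1\<close> and the vertex bound is 0, so only the empty graph
      remains, a yes-instance for parameter 0.\<close>
    let ?G = "\<lparr>pverts = {..<0::nat}, parcs = {}\<rparr>"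
    have G: "weighted_graph ?G (\<lambda>_. 1)" by (rule weighted_graphI) (auto simp: irrefl_def sym_def)
    have "saves {} (\<lambda>_. 1) {..<0::nat} 0"
      unfolding saves_def by (auto simp: partition_on_empty coloring_weight_def)
    then have "dual_weighted_coloring ?G (\<lambda>_. 1) 0" using dual_weighted_coloring_iff_saves[OF G] by simp
    moreover have "kernel_encoding = encode ?G (\<lambda>_. 1) 0"
      using many False by (simp add: kernel_encoding_def encode_flat)
    ultimately show ?thesis using G yes False
      by (intro exI[of _ ?G] exI[of _ "\<lambda>_. 1"] exI[of _ 0]) (auto simp: standard_vertices_def)
  qed
next
  case False
  define ks where "ks = kept_list n"
  define l where "l = length ks"
  define F where "F = {(i, j). i < l \<and> j < l \<and> (ks ! i, ks ! j) \<in> E}"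
  define w' where "w' i = min k (w (ks ! i))" for i
  let ?G = "\<lparr>pverts = {..<l}, parcs = F\<rparr>"
  have "0 < w' i" if "i < l" for i using that w kept_list_less k by (simp add: w'_def l_def ks_def)
  then have G: "weighted_graph ?G w'"
    using E by (intro weighted_graphI) (auto simp: F_def irrefl_def sym_def)
  have "distinct ks" by (simp add: ks_def kept_list_def)
  then have bij: "bij_betw ((!) ks) {..<l} (set ks)" by (intro bij_betw_nth) (auto simp: l_def)
  have "saves E (\<lambda>v. min k (w v)) (set ks) k \<longleftrightarrow> saves F w' {..<l} k"
    by (rule saves_relabel[OF _ bij]) (auto simp: F_def w'_def)
  then have "dual_weighted_coloring ?G w' k \<longleftrightarrow> saves E w {..<n} k"
    using dual_weighted_coloring_iff_saves[OF G] saves_truncate[of "set ks" E k w] saves_kept_iff[OF E]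
    by (simp add: ks_def)
  moreover have "reduced_encoding = encode ?G w' k"
  proof -
    have "of_bool ((q div l, q mod l) \<in> F) = (of_bool ((ks ! (q div l), ks ! (q mod l)) \<in> E) :: nat)"
      if "q < l * l" for q
    proof -
      have "0 < l" using that by (cases l) auto
      then have "q div l < l" "q mod l < l" using that by (auto simp: less_mult_imp_div_less)
      then show ?thesis by (simp add: F_def)
    qed
    then show ?thesis
      by (auto simp: reduced_encoding_def encode_flat Let_def ks_def[symmetric] l_def[symmetric] w'_def)
  qed
  then have "kernel_encoding = encode ?G w' k" using False by (simp add: kernel_encoding_def)
  ultimately show ?thesis using G False k
    by (intro exI[of _ ?G] exI[of _ w'] exI[of _ k])
      (auto simp: standard_vertices_def not_less l_def ks_def w'_def)
qed

lemma length_kernel_encoding: "length kernel_encoding \<le> n + n * n + 8"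
proof -
  have "length (kept_list n) + length (kept_list n) * length (kept_list n) \<le> n + n * n"
    using length_kept_list by (intro add_mono mult_mono) auto
  then show ?thesis by (simp add: kernel_encoding_def reduced_encoding_def Let_def)
qed

end

theorem theorem2:
  shows "\<exists>(c :: com) (p :: nat poly) (g :: nat \<Rightarrow> nat).
    \<forall>(G :: nat pair_pre_digraph) (w :: nat \<Rightarrow> nat) (k :: nat).
      weighted_graph G w \<and> standard_vertices G \<and> 0 < k \<longrightarrow>
      (\<exists>(G' :: nat pair_pre_digraph) (w' :: nat \<Rightarrow> nat) (k' :: nat) (t :: nat).
        computes c (encode G w k) (encode G' w' k') t \<and>
        t \<le> poly p (words_size (encode G w k)) \<and>
        weighted_graph G' w' \<and> standard_vertices G' \<and> (2 \<le> k \<longrightarrow> 0 < k') \<and>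
        (dual_weighted_coloring G' w' k' \<longleftrightarrow> dual_weighted_coloring G w k) \<and>
        card (pverts G') \<le> (2 ^ (k - 1) + 1) * (k - 1) \<and>
        k' \<le> k \<and>
        words_size (encode G' w' k') \<le> g k)"
proof -
  \<comment> \<open>The first summand bounds the running time and the second the size of the output,
    which \<open>computes\<close> also charges; 10 is \<open>8 + 2\<close>, from
    \<open>L + 2\<close> with \<open>L = N + 8\<close>.\<close>
  define p :: "nat poly" where "p = cost_poly kernelize * [:10, 1:]\<^sup>2 + [:8, 1:] * [:10, 1:]"
  define B :: "nat \<Rightarrow> nat" where "B k = (2 ^ (k - 1) + 1) * (k - 1)" for k
  \<comment> \<open>Bounds the encoding of at most \<open>B k\<close> vertices with weights and
    parameter at most \<open>k\<close>; the weights satisfy this by truncation.\<close>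
  define g where "g k = (2 + B k + B k * B k) * (B k + k + 2)" for k
  have "\<exists>G' w' k' t. computes kernelize (encode G w k) (encode G' w' k') t \<and>
        t \<le> poly p (words_size (encode G w k)) \<and>
        weighted_graph G' w' \<and> standard_vertices G' \<and> (2 \<le> k \<longrightarrow> 0 < k') \<and>
        (dual_weighted_coloring G' w' k' \<longleftrightarrow> dual_weighted_coloring G w k) \<and>
        card (pverts G') \<le> (2 ^ (k - 1) + 1) * (k - 1) \<and> k' \<le> k \<and>
        words_size (encode G' w' k') \<le> g k"
    if G: "weighted_graph G w" and std: "standard_vertices G" and k: "0 < k"
    for G :: "nat pair_pre_digraph" and w :: "nat \<Rightarrow> nat" and k :: nat
  proof -
    define n where "n = card (pverts G)"
    define xs where "xs = encode G w k"
    define N where "N = words_size xs"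
    have V: "pverts G = {..<n}" using std by (simp add: standard_vertices_def n_def)
    interpret dwc_instance n k w "parcs G" N "N + 8"
      unfolding n_def N_def xs_def by (rule dwc_instance_encode)
    have "selected 0 (input_memory xs)"
      using input_memory_encode[where G = G and w = w and k = k, folded n_def xs_def]
      by (auto simp: selected_def holds_instance_def kept_list_def)
    then obtain t m where t: "exec kernelize (input_memory xs) t m" "bounded_memory (N + 8) m"
      "output_words m = kernel_encoding" "t \<le> poly (cost_poly kernelize) N * (N + 8 + 2)\<^sup>2"
      using terminates_kernel bounded_input_memory[of xs] unfolding terminates_def N_def by blast
    \<comment> \<open>The output is read from the final memory, whose words are bounded by
      \<open>2 ^ (N + 8)\<close>.\<close>
    have "words_size kernel_encoding \<le> length kernel_encoding * (N + 8 + 2)"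
    proof (rule words_size_le)
      fix x assume "x \<in> set kernel_encoding"
      then have "x \<le> 2 ^ (N + 8)"
        using t(2) unfolding t(3)[symmetric] by (auto simp: output_words_def bounded_memory_def)
      then show "word_size x \<le> N + 8 + 2" by (rule word_size_le)
    qed
    also have "\<dots> \<le> (N + 8) * (N + 8 + 2)"
    proof (rule mult_le_mono1)
      have "2 + n + n * n \<le> N"
        using length_le_words_size[of xs] by (simp add: N_def xs_def length_encode n_def)
      then show "length kernel_encoding \<le> N + 8" using length_kernel_encoding by linarith
    qed
    finally have "words_size kernel_encoding \<le> (N + 8) * (N + 8 + 2)" .
    moreover have "poly p N = poly (cost_poly kernelize) N * (N + 8 + 2)\<^sup>2 + (N + 8) * (N + 8 + 2)"
      unfolding p_def poly_add poly_mult poly_power by (simp add: add.commute)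
    ultimately have "t + words_size kernel_encoding \<le> poly p N" using t(4) by linarith
    moreover have "computes kernelize xs kernel_encoding (t + words_size kernel_encoding)"
      unfolding computes_def using t(1,3) by blast
    moreover have "\<exists>G' w' k'. kernel_encoding = encode G' w' k' \<and> weighted_graph G' w' \<and>
        standard_vertices G' \<and> (2 \<le> k \<longrightarrow> 0 < k') \<and>
        (dual_weighted_coloring G' w' k' \<longleftrightarrow> saves (parcs G) w {..<n} k) \<and>
        card (pverts G') \<le> (2 ^ (k - 1) + 1) * (k - 1) \<and> k' \<le> k \<and> (\<forall>v<card (pverts G'). w' v \<le> k)"
      by (rule kernel_encoding_correct) (use weighted_graphD[OF G] k V in auto)
    then obtain G' w' k' where G': "kernel_encoding = encode G' w' k'" "weighted_graph G' w'"
      "standard_vertices G'" "2 \<le> k \<longrightarrow> 0 < k'"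
      "dual_weighted_coloring G' w' k' \<longleftrightarrow> saves (parcs G) w {..<n} k"
      "card (pverts G') \<le> (2 ^ (k - 1) + 1) * (k - 1)" "k' \<le> k" "\<forall>v<card (pverts G'). w' v \<le> k"
      by blast
    moreover have "words_size (encode G' w' k') \<le> g k"
      unfolding g_def B_def using G' by (intro words_size_encode_le) auto
    moreover have "saves (parcs G) w {..<n} k \<longleftrightarrow> dual_weighted_coloring G w k"
      using dual_weighted_coloring_iff_saves[OF G] V by simp
    ultimately show ?thesis unfolding N_def xs_def by metis
  qed
  then show ?thesis by blast
qed

end
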